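(* Let $\mathcal{M}\subseteq\mathbb{R}^{m\times n}$ be a linear subspace, let $r\ge 1$, and let $X_* \in \mathcal{R}_r\cap\mathcal{B}$ have rank exactly $r$. Assume $$T_{X_*}\mathcal{R}_r\cap T_{X_*}\mathcal{B}=\{0\}.$$ Then for $X\in\mathcal{B}$ close enough to $X_*$ the new iterate $$X_{\mathrm{new}}=\frac{\mathcal{P}_{\mathcal{M}}(\mathcal{T}_r(X))}{\|\mathcal{P}_{\mathcal{M}}(\mathcal{T}_r(X))\|_F}$$ is uniquely defined, and (for $X\ne X_*$) $$\frac{\|X_{\mathrm{new}}-X_*\|_F}{\|X-X_*\|_F}\le\cos\theta+O(\|X-X_*\|_F^2),$$ where $\theta\in(0,\frac{\pi}{2}]$ is the subspace angle between $T_{X_*}\mathcal{B}$ and $T_{X_*}\mathcal{R}_r$, defined by $$\cos\theta=\max_{\substack{X\in T_{X_*}\mathcal{B},\ Y\in T_{X_*}\mathcal{R}_r}}\frac{|\langle X,Y\rangle_F|}{\|X\|_F\|Y\|_F}$$ (maximum over nonzero $X,Y$). As a consequence, for starting values in $\mathcal{B}$ close enough to $X_*$, the iterates produced by repeatedly applying $X\mapsto X_{\mathrm{new}}$ are uniquely defined and converge to $X_*$ at a linear rate.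
   Context: $\langle\cdot,\cdot\rangle_F$ and $\|\cdot\|_F$ are the Frobenius inner product and norm on $\mathbb{R}^{m\times n}$. $\mathcal{P}_{\mathcal{M}}$ is the orthogonal projection (with respect to $\langle\cdot,\cdot\rangle_F$) of $\mathbb{R}^{m\times n}$ onto $\mathcal{M}$. $\mathcal{B}=\{X\in\mathcal{M}:\|X\|_F=1\}$ and $\mathcal{R}_r=\{X\in\mathbb{R}^{m\times n}:\operatorname{rank}(X)\le r\}$. $\mathcal{T}_r$ is singular value truncation: if $X=U\Sigma V^T$ is an SVD with $\Sigma=\operatorname{diag}(\sigma_1,\dots,\sigma_{\min(m,n)})$, $\sigma_1\ge\sigma_2\ge\dots\ge 0$, then $\mathcal{T}_r(X)=U\operatorname{diag}(\sigma_1,\dots,\sigma_r,0,\dots,0)V^T$ (a best rank-$r$ approximation of $X$ in Frobenius norm). "$X_{\mathrm{new}}$ is uniquely defined" means that $\mathcal{T}_r(X)$ does not depend on the choice of SVD and $\mathcal{P}_{\mathcal{M}}(\mathcal{T}_r(X))\neq0$. $T_{X_*}\mathcal{B}$ is the orthogonal complement of $X_*$ within $\mathcal{M}$. If $X_*=U_*\Sigma_*V_*^T$ is a thin SVD ($\Sigma_*\in\mathbb{R}^{r\times r}$ with positive singular values) and $[U_*\ U_*^\perp]$, $[V_*\ V_*^\perp]$ are orthogonal matrices of sizes $m\times m$ and $n\times n$, then $T_{X_*}\mathcal{R}_r$ is the tangent space at $X_*$ of the manifold of rank-$r$ matrices, $$T_{X_*}\mathcal{R}_r=\left\{[U_*\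 U_*^\perp]\begin{bmatrix}A&B\\C&0\end{bmatrix}[V_*\ V_*^\perp]^T: A\in\mathbb{R}^{r\times r},\ B\in\mathbb{R}^{r\times(n-r)},\ C\in\mathbb{R}^{(m-r)\times r}\right\}.$$ The $O(\cdot)$ is for $X\to X_*$ in $\mathcal{B}$, with a constant that may depend on $X_*$ and $\mathcal{M}$. A maximum over an empty set (the case $T_{X_*}\mathcal{B}=\{0\}$) is read as $0$. Linear rate means that there is $q<1$ such that $\|X_{k+1}-X_*\|_F\le q\|X_k-X_*\|_F$ for all $k$, where $X_k$ are the iterates. *)

theory Defs
  imports "HOL-Analysis.Analysis" "HOL-Library.Landau_Symbols"
begin

text \<open>
  An \<open>m \<times> n\<close> matrix is an element of \<^typ>\<open>real^'n^'m\<close> with \<open>CARD('m) = m\<close> and \<open>CARD('n) = n\<close>.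
  On this type, \<^term>\<open>inner\<close> and \<^term>\<open>norm\<close> are the Frobenius inner product and the Frobenius norm.

  The index types carry no order, so rows and columns are numbered \<open>0, 1, 2, \<dots>\<close> by the following
  bijection from the index type onto \<open>{..<CARD('a)}\<close>; ``the first \<open>r\<close> columns'' refers to it.
\<close>

definition idx :: "'a::finite \<Rightarrow> nat" where
  "idx = to_nat_on UNIV"

lemma bij_betw_idx: "bij_betw (idx :: 'a::finite \<Rightarrow> nat) UNIV {..<CARD('a)}"
  unfolding idx_def by (rule to_nat_on_finite) simp

definition diag_matrix :: "(nat \<Rightarrow> real) \<Rightarrow> real^'n^'m" where
  "diag_matrix s = (\<chi> i j. if idx i = idx j then s (idx i) else 0)"

text \<open>Only the values \<open>s k\<close> with \<open>k < min m n\<close> matter.\<close>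

definition is_svd :: "real^'n^'m \<Rightarrow> real^'m^'m \<Rightarrow> (nat \<Rightarrow> real) \<Rightarrow> real^'n^'n \<Rightarrow> bool" where
  "is_svd X U s V \<longleftrightarrow>
     orthogonal_matrix U \<and> orthogonal_matrix V \<and>
     (\<forall>k < min CARD('m) CARD('n). 0 \<le> s k) \<and>
     (\<forall>j k. j \<le> k \<and> k < min CARD('m) CARD('n) \<longrightarrow> s k \<le> s j) \<and>
     X = U ** diag_matrix s ** transpose V"

text \<open>All results of truncating some SVD of \<open>X\<close>; this need not be a singleton.\<close>

definition svd_truncations :: "nat \<Rightarrow> real^'n^'m \<Rightarrow> (real^'n^'m) set" where
  "svd_truncations r X =
     {U ** diag_matrix (\<lambda>k. if k < r then s k else 0) ** transpose V | U s V. is_svd X U s V}"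

text \<open>Meaningful only if \<^term>\<open>svd_truncations r X\<close> has exactly one element.\<close>

definition sv_truncate :: "nat \<Rightarrow> real^'n^'m \<Rightarrow> real^'n^'m" where
  "sv_truncate r X = (THE Y. Y \<in> svd_truncations r X)"

definition orth_proj :: "'a::euclidean_space set \<Rightarrow> 'a \<Rightarrow> 'a" where
  "orth_proj M X = (THE P. P \<in> M \<and> (\<forall>Y\<in>M. orthogonal (X - P) Y))"

definition unit_sphere_in :: "'a::euclidean_space set \<Rightarrow> 'a set" where
  "unit_sphere_in M = {X \<in> M. norm X = 1}"

definition new_iterate_defined :: "(real^'n^'m) set \<Rightarrow> nat \<Rightarrow> real^'n^'m \<Rightarrow> bool" where
  "new_iterate_defined M r X \<longleftrightarrow>
     (\<exists>!Y. Y \<in> svd_truncations r X) \<and> orth_proj M (sv_truncate r X) \<noteq> 0"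

definition new_iterate :: "(real^'n^'m) set \<Rightarrow> nat \<Rightarrow> real^'n^'m \<Rightarrow> real^'n^'m" where
  "new_iterate M r X =
     orth_proj M (sv_truncate r X) /\<^sub>R norm (orth_proj M (sv_truncate r X))"

definition sphere_tangent :: "'a::euclidean_space set \<Rightarrow> 'a \<Rightarrow> 'a set" where
  "sphere_tangent M X = {Y \<in> M. orthogonal X Y}"

text \<open>
  The tangent space, at a rank \<open>r\<close> matrix with SVD \<open>U \<Sigma> V\<^sup>T\<close>, of the manifold of rank \<open>r\<close> matrices.
  The first \<open>r\<close> columns of \<open>U\<close> and \<open>V\<close> are the factors of the thin SVD and the
  remaining columns are their orthonormal completions; \<open>W\<close> is the block matrix
  with blocks \<open>A, B, C, 0\<close>.
\<close>

definition rank_tangent :: "nat \<Rightarrow> real^'m^'m \<Rightarrow> real^'n^'n \<Rightarrow> (real^'n^'m) set" where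
  "rank_tangent r U V =
     {U ** W ** transpose V | W. \<forall>i j. r \<le> idx i \<and> r \<le> idx j \<longrightarrow> W $ i $ j = 0}"

definition subspace_cosines :: "'a::euclidean_space set \<Rightarrow> 'a set \<Rightarrow> real set" where
  "subspace_cosines S T =
     {\<bar>X \<bullet> Y\<bar> / (norm X * norm Y) | X Y. X \<in> S \<and> X \<noteq> 0 \<and> Y \<in> T \<and> Y \<noteq> 0}"

text \<open>
  The cosine of the angle is an attained maximum, read as \<open>0\<close> over the empty set. This determines
  \<open>\<theta>\<close> uniquely, as \<^term>\<open>cos\<close> is injective on the given interval.
\<close>

definition is_subspace_angle :: "'a::euclidean_space set \<Rightarrow> 'a set \<Rightarrow> real \<Rightarrow> bool" where
  "is_subspace_angle S T \<theta> \<longleftrightarrow>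
     \<theta> \<in> {0..pi/2} \<and>
     (if subspace_cosines S T = {} then cos \<theta> = 0
      else cos \<theta> \<in> subspace_cosines S T \<and> (\<forall>c \<in> subspace_cosines S T. c \<le> cos \<theta>))"

definition linear_rate :: "(nat \<Rightarrow> 'a::real_normed_vector) \<Rightarrow> 'a \<Rightarrow> bool" where
  "linear_rate x l \<longleftrightarrow> (\<exists>q<1. \<forall>k. norm (x (Suc k) - l) \<le> q * norm (x k - l))"

end

theory Submission imports Defs
begin

text \<open>Let eps be the distance from X to \<open>Xs\<close>, T the tangent space of the rank r
  matrices at \<open>Xs\<close>, and S the tangent space of the unit sphere of \<open>M\<close>.
  Near \<open>Xs\<close>, truncation is to first order the orthogonal projection onto T: the
  truncation Y satisfies Y - Xs = P_T (X - Xs) + O(eps^2) (\<open>truncation_perturbation\<close>).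
  On the sphere, X - Xs lies in S up to O(eps^2), and projecting Y onto \<open>M\<close> and
  normalising leaves, to first order, the S-component of P_T (X - Xs). Passing from S to T and back
  costs a factor cos theta each way, so the error ratio is at most (cos theta)^2 + O(eps).

  Since S and T meet only in 0, compactness gives cos theta < 1
  (\<open>subspace_angle_exists\<close>). If cos theta > 0, the room between (cos theta)^2 and cos
  theta absorbs the O(eps) term on a small ball. If cos theta = 0 there is no room, but then S is
  orthogonal to T: the part of X orthogonal to \<open>Xs\<close> has row and column spaces
  orthogonal to those of \<open>Xs\<close>, truncation removes exactly that part, and one step lands
  on \<open>Xs\<close>. Either way the ratio is at most cos theta
  (\<open>new_iterate_contraction\<close>), so the quadratic error term can be taken to be 0, and
  convergence follows by induction.

  The truncation is well defined because of a gap: by \<open>weyl_singular_value_le\<close> the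
  first r singular values of X stay bounded below while the others are at most eps, and a projection
  that commutes with the Gram matrix and respects such a gap is unique
  (\<open>spectral_projection_unique\<close>). A singular value decomposition is supplied by
  \<open>svd_exists\<close>, through a variational argument.\<close>

section \<open>Frobenius inner product\<close>

lemma inner_matrix_mult_left:
  fixes A :: "real^'n^'m" and B :: "real^'p^'n" and C :: "real^'p^'m"
  shows "(A ** B) \<bullet> C = B \<bullet> (transpose A ** C)"
proof -
  have "(A ** B) \<bullet> C = (\<Sum>i\<in>UNIV. \<Sum>j\<in>UNIV. \<Sum>k\<in>UNIV. A$i$k * B$k$j * C$i$j)"
    by (simp add: inner_vec_def matrix_matrix_mult_def sum_distrib_right)
  also have "\<dots> = (\<Sum>k\<in>UNIV. \<Sum>j\<in>UNIV. \<Sum>i\<in>UNIV. A$i$k * B$k$j * C$i$j)"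
    by (subst sum.swap, subst (2) sum.swap, subst sum.swap) (rule refl)
  also have "\<dots> = B \<bullet> (transpose A ** C)"
    by (simp add: inner_vec_def matrix_matrix_mult_def sum_distrib_left transpose_def mult_ac)
  finally show ?thesis .
qed

lemma inner_transpose:
  fixes A B :: "real^'n^'m"
  shows "transpose A \<bullet> transpose B = A \<bullet> B"
  by (simp add: inner_vec_def transpose_def) (rule sum.swap)

lemma norm_transpose: "norm (transpose A) = norm (A :: real^'n^'m)"
  by (simp add: norm_eq_sqrt_inner inner_transpose)

lemma inner_matrix_mult_right:
  fixes A :: "real^'n^'m" and B :: "real^'p^'n" and C :: "real^'p^'m"
  shows "(A ** B) \<bullet> C = A \<bullet> (C ** transpose B)"
proof -
  have "(A ** B) \<bullet> C = (transpose B ** transpose A) \<bullet> transpose C"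
    by (simp add: inner_transpose flip: matrix_transpose_mul)
  also have "\<dots> = transpose A \<bullet> (B ** transpose C)"
    by (simp add: inner_matrix_mult_left)
  also have "\<dots> = A \<bullet> (C ** transpose B)"
    using inner_transpose[of A "C ** transpose B"] by (simp add: matrix_transpose_mul)
  finally show ?thesis .
qed

lemma inner_mat_1: "(mat 1 :: real^'n^'n) \<bullet> B = (\<Sum>i\<in>UNIV. B$i$i)"
  by (simp add: inner_vec_def mat_def if_distrib if_distribR cong: if_cong)

lemma norm_matrix_columns: "(norm (A :: real^'n^'m))\<^sup>2 = (\<Sum>j\<in>UNIV. (norm (column j A))\<^sup>2)"
  unfolding power2_norm_eq_inner inner_vec_def by (simp add: column_def) (rule sum.swap)

lemma norm_matrix_vector_le: "norm (A *v x) \<le> norm A * norm (x :: real^'n)" for A :: "real^'n^'m"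
proof (rule power2_le_imp_le)
  have "(norm (A *v x))\<^sup>2 = (\<Sum>i\<in>UNIV. (A$i \<bullet> x)\<^sup>2)"
    unfolding power2_norm_eq_inner by (simp add: inner_vec_def matrix_mult_dot power2_eq_square)
  also have "\<dots> \<le> (\<Sum>i\<in>UNIV. (norm (A$i))\<^sup>2 * (norm x)\<^sup>2)"
    by (intro sum_mono) (metis Cauchy_Schwarz_ineq power2_norm_eq_inner)
  also have "\<dots> = (norm A * norm x)\<^sup>2"
    unfolding power_mult_distrib power2_norm_eq_inner[of A] inner_vec_def[of A]
    by (simp add: sum_distrib_right power2_norm_eq_inner)
  finally show "(norm (A *v x))\<^sup>2 \<le> (norm A * norm x)\<^sup>2" .
qed simp

lemma column_matrix_mult: "column j (A ** B) = A *v column j (B :: real^'p^'n)"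
  by (simp add: vec_eq_iff column_def matrix_matrix_mult_def matrix_vector_mult_def)

lemma norm_matrix_mult_le: "norm (A ** B) \<le> norm A * norm B"
  for A :: "real^'n^'m" and B :: "real^'p^'n"
proof (rule power2_le_imp_le)
  have "(norm (A ** B))\<^sup>2 = (\<Sum>j\<in>UNIV. (norm (A *v column j B))\<^sup>2)"
    by (simp add: norm_matrix_columns column_matrix_mult)
  also have "\<dots> \<le> (\<Sum>j\<in>UNIV. (norm A * norm (column j B))\<^sup>2)"
    by (intro sum_mono power_mono norm_matrix_vector_le) simp
  also have "\<dots> = (norm A * norm B)\<^sup>2"
    by (simp add: power_mult_distrib norm_matrix_columns[of B] sum_distrib_left)
  finally show "(norm (A ** B))\<^sup>2 \<le> (norm A * norm B)\<^sup>2" .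
qed simp

lemma bounded_bilinear_matrix_mult:
  "bounded_bilinear ((**) :: real^'n^'m \<Rightarrow> real^'p^'n \<Rightarrow> real^'p^'m)"
proof
  fix A A' :: "real^'n^'m" and B B' :: "real^'p^'n" and c :: real
  show "(A + A') ** B = A ** B + A' ** B"
    by (simp add: vec_eq_iff matrix_matrix_mult_def distrib_right sum.distrib)
  show "A ** (B + B') = A ** B + A ** B'"
    by (rule matrix_add_ldistrib)
  show "(c *\<^sub>R A) ** B = c *\<^sub>R (A ** B)"
    by (rule scalar_matrix_assoc[symmetric])
  show "A ** (c *\<^sub>R B) = c *\<^sub>R (A ** B)"
    by (simp add: vec_eq_iff matrix_matrix_mult_def sum_distrib_left mult_ac)
  show "\<exists>K. \<forall>A B. norm ((A :: real^'n^'m) ** (B :: real^'p^'n)) \<le> norm A * norm B * K"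
    by (rule exI[of _ 1]) (simp add: norm_matrix_mult_le)
qed

lemmas matrix_mult_add_left = bounded_bilinear.add_left[OF bounded_bilinear_matrix_mult]
lemmas matrix_mult_diff_left = bounded_bilinear.diff_left[OF bounded_bilinear_matrix_mult]
lemmas matrix_mult_diff_right = bounded_bilinear.diff_right[OF bounded_bilinear_matrix_mult]
lemmas matrix_mult_scaleR_left = bounded_bilinear.scaleR_left[OF bounded_bilinear_matrix_mult]
lemmas matrix_mult_scaleR_right = bounded_bilinear.scaleR_right[OF bounded_bilinear_matrix_mult]

lemma bounded_linear_transpose: "bounded_linear (transpose :: real^'n^'m \<Rightarrow> real^'m^'n)"
proof
  show "\<exists>K. \<forall>x. norm (transpose (x :: real^'n^'m)) \<le> norm x * K"
    by (metis mult.right_neutral norm_transpose order_refl)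
qed (simp_all add: vec_eq_iff transpose_def)

lemmas transpose_add = bounded_linear.axioms(1)[OF bounded_linear_transpose, THEN linear_add]
lemmas transpose_zero = bounded_linear.axioms(1)[OF bounded_linear_transpose, THEN linear_0]
lemmas transpose_diff = bounded_linear.axioms(1)[OF bounded_linear_transpose, THEN linear_diff]

text \<open>Each column is the image of a unit vector and so has norm at most b. The sharp factor
  would be the square root of the number of columns; only the existence of some constant matters for
  the quadratic estimates.\<close>

lemma norm_matrix_le_of_vector:
  fixes A :: "real^'n^'m"
  assumes "\<And>v. norm (A *v v) \<le> b * norm v"
  shows "norm A \<le> real CARD('n) * b"
proof -
  have b: "norm (column j A) \<le> b" for j
    using assms[of "axis j 1"] by (simp add: matrix_vector_mult_basis)
  then have "0 \<le> b" using norm_ge_zero order_trans by blast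
  have "(norm A)\<^sup>2 \<le> (\<Sum>j\<in>(UNIV::'n set). b\<^sup>2)"
    unfolding norm_matrix_columns by (intro sum_mono power_mono b) simp
  also have "\<dots> = real CARD('n) * b\<^sup>2" by simp
  also have "\<dots> \<le> (real CARD('n))\<^sup>2 * b\<^sup>2"
    by (intro mult_right_mono) (auto simp: power2_eq_square Suc_le_eq)
  finally show ?thesis
    using \<open>0 \<le> b\<close> by (auto simp flip: power_mult_distrib intro: power2_le_imp_le)
qed

section \<open>Projections separated by a quadratic form\<close>

text \<open>
  With \<open>K = P Q\<close>, the trace of \<open>K\<^sup>T H K\<close> is at most \<open>b \<parallel>K\<parallel>\<^sup>2\<close> by the bound on the range of \<open>P\<close>;
  as \<open>H\<close> commutes with \<open>K\<close>, it is also the trace of \<open>K H K\<^sup>T\<close>, hence at least \<open>a \<parallel>K\<parallel>\<^sup>2\<close>.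
\<close>

lemma matrix_mult_eq_zero_of_projections:
  fixes H P Q :: "real^'n^'n"
  assumes P: "transpose P = P" and Q: "transpose Q = Q"
    and "b < a"
    and HP: "H ** P = P ** H" and HQ: "H ** Q = Q ** H"
    and upper: "\<And>v. P *v v = v \<Longrightarrow> v \<bullet> (H *v v) \<le> b * (v \<bullet> v)"
    and lower: "\<And>v. Q *v v = v \<Longrightarrow> a * (v \<bullet> v) \<le> v \<bullet> (H *v v)"
    and "P ** P = P" "Q ** Q = Q"
  shows "P ** Q = 0"
proof -
  have fixed: "F *v column j (F ** G) = column j (F ** G)" if "F ** F = F" for F G :: "real^'n^'n" and j
    by (metis that column_matrix_mult matrix_mul_assoc)
  have inner_cols: "A \<bullet> B = (\<Sum>j\<in>UNIV. column j A \<bullet> column j B)" for A B :: "real^'n^'n"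
    by (simp add: inner_vec_def column_def) (rule sum.swap)
  let ?K = "P ** Q"
  have "?K \<bullet> (H ** ?K) \<le> b * (?K \<bullet> ?K)"
    unfolding inner_cols column_matrix_mult[of _ H] sum_distrib_left
    by (intro sum_mono upper fixed assms)
  moreover have "a * ((Q ** P) \<bullet> (Q ** P)) \<le> (Q ** P) \<bullet> (H ** (Q ** P))"
    unfolding inner_cols column_matrix_mult[of _ H] sum_distrib_left
    by (intro sum_mono lower fixed assms)
  moreover have "(Q ** P) = transpose ?K"
    by (simp add: matrix_transpose_mul P Q)
  moreover have "transpose ?K \<bullet> (H ** transpose ?K) = ?K \<bullet> (H ** ?K)"
  proof -
    \<comment> \<open>Idempotence and commutation collapse each quadratic form to a pairing of
      \<open>H\<close> with \<open>P ** Q\<close> or \<open>Q ** P\<close>; these two agree because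
      \<open>H\<close> commutes with \<open>P\<close>.\<close>
    have swap: "(H ** (F ** G)) \<bullet> (F ** G) = H \<bullet> (F ** G)"
      if "transpose F = F" "F ** F = F" "transpose G = G" "G ** G = G" "H ** F = F ** H"
      for F G :: "real^'n^'n"
    proof -
      have "(H ** (F ** G)) \<bullet> (F ** G) = ((H ** F) ** G) \<bullet> (F ** G)"
        by (simp add: matrix_mul_assoc)
      also have "\<dots> = (H ** F) \<bullet> (F ** (G ** G))"
        by (simp add: inner_matrix_mult_right that(3) matrix_mul_assoc)
      also have "\<dots> = (F ** H) \<bullet> (F ** G)"
        by (simp add: that)
      also have "\<dots> = H \<bullet> ((F ** F) ** G)"
        by (simp add: inner_matrix_mult_left that(1) matrix_mul_assoc)
      finally show ?thesis by (simp add: that)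
    qed
    have "transpose ?K \<bullet> (H ** transpose ?K) = H \<bullet> (Q ** P)"
      using swap[of Q P] by (simp add: matrix_transpose_mul assms inner_commute)
    also have "\<dots> = (H ** P) \<bullet> Q"
      by (simp add: inner_matrix_mult_right P)
    also have "\<dots> = H \<bullet> (P ** Q)"
      by (simp add: HP inner_matrix_mult_left P)
    also have "\<dots> = ?K \<bullet> (H ** ?K)"
      using swap[of P Q] by (simp add: assms inner_commute)
    finally show ?thesis .
  qed
  ultimately have "(a - b) * (?K \<bullet> ?K) \<le> 0"
    by (simp add: inner_transpose algebra_simps)
  then have "?K \<bullet> ?K \<le> 0"
    using \<open>b < a\<close> by (simp add: mult_le_0_iff)
  then show ?thesis by (metis inner_eq_zero_iff inner_ge_zero order_antisym)
qed

section \<open>Diagonal matrices and coordinate projections\<close>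

lemma idx_less: "idx (i :: 'a::finite) < CARD('a::finite)"
  using bij_betw_apply[OF bij_betw_idx, of i] by simp

lemma idx_eq_iff [simp]: "idx i = idx j \<longleftrightarrow> i = (j :: 'a::finite)"
  using bij_betw_imp_inj_on[OF bij_betw_idx] by (auto simp: inj_on_def)

lemma obtain_idx:
  assumes "k < CARD('a::finite)"
  obtains i :: "'a::finite" where "idx i = k"
  using bij_betw_imp_surj_on[OF bij_betw_idx, where ?'a1 = 'a] assms by (metis imageE lessThan_iff)

lemma card_idx: "card {i. idx (i :: 'a::finite) \<in> I} = card (I \<inter> {..<CARD('a::finite)})"
proof -
  have "idx ` {i :: 'a. idx i \<in> I} = I \<inter> {..<CARD('a)}"
    using bij_betw_imp_surj_on[OF bij_betw_idx, where ?'a1 = 'a] by auto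
  then show ?thesis
    by (metis (no_types, lifting) card_image idx_eq_iff inj_onI)
qed

lemma sum_UNIV_single:
  assumes "\<And>k. k \<noteq> l \<Longrightarrow> f k = 0"
  shows "sum f UNIV = f (l :: 'a::finite)"
  using assms by (subst sum.remove[of _ l]) auto

lemma diag_matrix_cong:
  assumes "\<And>k. k < CARD('m) \<Longrightarrow> k < CARD('n) \<Longrightarrow> s k = t k"
  shows "diag_matrix s = (diag_matrix t :: real^'n^'m)"
proof -
  have "s (idx i) = t (idx i)" if "idx i = idx j" for i :: 'm and j :: 'n
    using assms idx_less[of i] idx_less[of j] that by simp
  then show ?thesis by (simp add: diag_matrix_def vec_eq_iff)
qed

lemma transpose_diag_matrix: "transpose (diag_matrix s :: real^'n^'m) = diag_matrix s"
  by (auto simp: vec_eq_iff diag_matrix_def transpose_def)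

lemma diag_matrix_mult:
  "(diag_matrix s :: real^'n^'m) ** (diag_matrix t :: real^'p^'n) =
    diag_matrix (\<lambda>k. if k < CARD('n) then s k * t k else 0)"
proof -
  have "((diag_matrix s :: real^'n^'m) ** (diag_matrix t :: real^'p^'n)) $ i $ j =
    diag_matrix (\<lambda>k. if k < CARD('n) then s k * t k else 0) $ i $ j" for i j
  proof (cases "idx i < CARD('n)")
    case True
    then obtain l :: 'n where l: "idx l = idx i" by (rule obtain_idx)
    show ?thesis
      unfolding matrix_matrix_mult_def
      by (simp, subst sum_UNIV_single[of l]) (use True in \<open>auto simp: diag_matrix_def l[symmetric]\<close>)
  next
    case False
    then have "idx i \<noteq> idx k" for k :: 'n using idx_less[of k] by auto
    then show ?thesis using False by (simp add: matrix_matrix_mult_def diag_matrix_def)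
  qed
  then show ?thesis by (simp add: vec_eq_iff)
qed

lemma diag_matrix_mult_vector: "((diag_matrix s :: real^'n^'n) *v y) $ j = s (idx j) * y $ j"
  unfolding matrix_vector_mult_def
  by (simp, subst sum_UNIV_single[of j]) (auto simp: diag_matrix_def)

lemma orthogonal_matrix_cancel:
  assumes "orthogonal_matrix (V :: real^'n^'n)"
  shows "(A ** transpose V) ** (V ** B) = A ** B"
  using assms by (metis matrix_mul_assoc matrix_mul_rid orthogonal_matrix)

text \<open>For orthogonal \<open>V\<close> this is the orthogonal projection onto the span of the
  columns numbered by \<open>I\<close>. Truncation is multiplication by such a projection, which
  replaces individual singular vectors, which are not unique, by singular subspaces.\<close>

definition coord_proj :: "real^'n^'n \<Rightarrow> nat set \<Rightarrow> real^'n^'n" where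
  "coord_proj V I = V ** diag_matrix (indicator I) ** transpose V"

lemma transpose_coord_proj: "transpose (coord_proj V I) = coord_proj V I"
  by (simp add: coord_proj_def matrix_transpose_mul transpose_diag_matrix matrix_mul_assoc)

lemma svd_mult:
  fixes U :: "real^'m^'m" and V :: "real^'n^'n" and W :: "real^'p^'p"
  assumes "orthogonal_matrix V"
  shows "(U ** (diag_matrix s :: real^'n^'m) ** transpose V) ** (V ** (diag_matrix t :: real^'p^'n) ** W) =
    U ** diag_matrix (\<lambda>k. if k < CARD('n) then s k * t k else 0) ** W"
proof -
  have "(U ** (diag_matrix s :: real^'n^'m) ** transpose V) ** (V ** (diag_matrix t :: real^'p^'n) ** W)
     = U ** ((diag_matrix s :: real^'n^'m) ** (diag_matrix t :: real^'p^'n)) ** W"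
    by (metis assms matrix_mul_assoc orthogonal_matrix_cancel)
  then show ?thesis by (simp add: diag_matrix_mult)
qed

lemma coord_proj_mult:
  assumes "orthogonal_matrix (V :: real^'n^'n)"
  shows "coord_proj V I ** coord_proj V J = coord_proj V (I \<inter> J)"
  unfolding coord_proj_def svd_mult[OF assms]
  by (intro arg_cong2[of _ _ _ _ "(**)"] refl diag_matrix_cong) (auto simp: indicator_def)

lemma coord_proj_compl:
  assumes "orthogonal_matrix (V :: real^'n^'n)"
  shows "coord_proj V (- I) = mat 1 - coord_proj V I"
proof -
  have "diag_matrix (indicator (- I)) + diag_matrix (indicator I) = (mat 1 :: real^'n^'n)"
    by (simp add: vec_eq_iff diag_matrix_def mat_def indicator_def)
  then have "coord_proj V (- I) + coord_proj V I = V ** mat 1 ** transpose V"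
    unfolding coord_proj_def matrix_mult_add_left[symmetric] matrix_add_ldistrib[symmetric] by simp
  also have "\<dots> = mat 1" using assms by (simp add: orthogonal_matrix_def)
  finally show ?thesis by (simp add: algebra_simps)
qed

lemma svd_mult_coord_proj:
  fixes U :: "real^'m^'m" and V :: "real^'n^'n"
  assumes "orthogonal_matrix V"
  shows "(U ** (diag_matrix s :: real^'n^'m) ** transpose V) ** coord_proj V I =
    U ** diag_matrix (\<lambda>k. if k \<in> I then s k else 0) ** transpose V"
  unfolding coord_proj_def svd_mult[OF assms]
  by (intro arg_cong2[of _ _ _ _ "(**)"] refl diag_matrix_cong) (auto simp: indicator_def)

lemma coord_proj_mult_svd:
  fixes U :: "real^'m^'m" and V :: "real^'n^'n"
  assumes "orthogonal_matrix U"
  shows "coord_proj U I ** (U ** (diag_matrix s :: real^'n^'m) ** transpose V) =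
    U ** diag_matrix (\<lambda>k. if k \<in> I then s k else 0) ** transpose V"
  unfolding coord_proj_def svd_mult[OF assms]
  by (intro arg_cong2[of _ _ _ _ "(**)"] refl diag_matrix_cong) (auto simp: indicator_def)

lemma transpose_mult_vector_nth: "(transpose V *v v) $ j = column j V \<bullet> v"
  by (simp add: matrix_mult_dot column_def transpose_def del: transpose_matrix_vector)

lemma column_inner_coord_proj:
  assumes "orthogonal_matrix (V :: real^'n^'n)"
  shows "column j V \<bullet> (coord_proj V I *v v) = indicator I (idx j) * (column j V \<bullet> v)"
proof -
  have "transpose V ** coord_proj V I = diag_matrix (indicator I) ** transpose V"
    using assms by (simp add: coord_proj_def matrix_mul_assoc orthogonal_matrix_def)
  then have "transpose V *v (coord_proj V I *v v) = diag_matrix (indicator I) *v (transpose V *v v)"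
    by (simp only: matrix_vector_mul_assoc)
  then show ?thesis
    unfolding transpose_mult_vector_nth[symmetric]
    by (simp add: diag_matrix_mult_vector del: transpose_matrix_vector)
qed

lemma sum_column_inner_square:
  assumes "orthogonal_matrix (V :: real^'n^'n)"
  shows "(\<Sum>j\<in>UNIV. (column j V \<bullet> v)\<^sup>2) = (norm v)\<^sup>2"
proof -
  have "(\<Sum>j\<in>UNIV. (column j V \<bullet> v)\<^sup>2) = (transpose V *v v) \<bullet> (transpose V *v v)"
    unfolding inner_vec_def transpose_mult_vector_nth by (simp add: power2_eq_square)
  also have "\<dots> = v \<bullet> ((V ** transpose V) *v v)"
    by (simp add: dot_lmul_matrix matrix_vector_mul_assoc[symmetric])
  finally show ?thesis
    using assms by (simp add: orthogonal_matrix_def power2_norm_eq_inner)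
qed

text \<open>Expand v in the columns of \<open>V\<close>. When there are more columns than rows, the
  surplus columns of \<open>V\<close> meet no diagonal entry and are sent to 0, whatever value s
  takes there; hence the case distinction.\<close>

lemma norm_svd_mult_vector:
  fixes U :: "real^'m^'m" and V :: "real^'n^'n"
  assumes "orthogonal_matrix U"
  shows "(norm ((U ** (diag_matrix s :: real^'n^'m) ** transpose V) *v v))\<^sup>2 =
    (\<Sum>j\<in>UNIV. (if idx j < CARD('m) then (s (idx j))\<^sup>2 else 0) * (column j V \<bullet> v)\<^sup>2)"
proof -
  define y where "y = transpose V *v v"
  let ?D = "diag_matrix s :: real^'n^'m"
  have "(U ** ?D ** transpose V) *v v = U *v (?D *v y)"
    by (simp add: y_def matrix_vector_mul_assoc matrix_mul_assoc del: transpose_matrix_vector)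
  then have "(norm ((U ** ?D ** transpose V) *v v))\<^sup>2 = (U *v (?D *v y)) \<bullet> (U *v (?D *v y))"
    by (simp add: power2_norm_eq_inner)
  also have "\<dots> = (?D *v y) \<bullet> ((transpose U ** U) *v (?D *v y))"
    using dot_lmul_matrix[of "U *v (?D *v y)" U "?D *v y"]
    by (simp add: inner_commute matrix_vector_mul_assoc[symmetric])
  also have "\<dots> = y \<bullet> (transpose ?D *v (?D *v y))"
    using assms dot_lmul_matrix[of "?D *v y" ?D y]
    by (simp add: orthogonal_matrix_def inner_commute)
  also have "\<dots> = ((diag_matrix (\<lambda>k. if k < CARD('m) then s k * s k else 0) :: real^'n^'n) *v y) \<bullet> y"
    by (simp add: matrix_vector_mul_assoc transpose_diag_matrix diag_matrix_mult inner_commute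
        del: transpose_matrix_vector)
  also have "\<dots> = (\<Sum>j\<in>UNIV. (if idx j < CARD('m) then (s (idx j))\<^sup>2 else 0) * (y $ j)\<^sup>2)"
    by (auto simp: inner_vec_def diag_matrix_mult_vector power2_eq_square intro!: sum.cong)
  finally show ?thesis by (simp add: y_def transpose_mult_vector_nth del: transpose_matrix_vector)
qed

lemma norm_svd_mult_vector_le:
  fixes U :: "real^'m^'m" and V :: "real^'n^'n"
  assumes "orthogonal_matrix U" "orthogonal_matrix V" and "0 \<le> b"
    and "\<And>j. column j V \<bullet> v \<noteq> 0 \<Longrightarrow> idx j < CARD('m) \<Longrightarrow> \<bar>s (idx j)\<bar> \<le> b"
  shows "norm ((U ** (diag_matrix s :: real^'n^'m) ** transpose V) *v v) \<le> b * norm v"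
proof (rule power2_le_imp_le)
  have "(norm ((U ** (diag_matrix s :: real^'n^'m) ** transpose V) *v v))\<^sup>2
      \<le> (\<Sum>j\<in>UNIV. b\<^sup>2 * (column j V \<bullet> v)\<^sup>2)"
    unfolding norm_svd_mult_vector[OF assms(1)]
  proof (rule sum_mono)
    fix j
    show "(if idx j < CARD('m) then (s (idx j))\<^sup>2 else 0) * (column j V \<bullet> v)\<^sup>2 \<le> b\<^sup>2 * (column j V \<bullet> v)\<^sup>2"
      using assms(3) assms(4)[of j]
      by (cases "column j V \<bullet> v = 0") (auto intro!: mult_right_mono simp: abs_le_square_iff[symmetric])
  qed
  then show "(norm ((U ** (diag_matrix s :: real^'n^'m) ** transpose V) *v v))\<^sup>2 \<le> (b * norm v)\<^sup>2"
    by (simp add: sum_distrib_left[symmetric] sum_column_inner_square[OF assms(2)] power_mult_distrib)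
qed (use assms in simp)

lemma norm_svd_mult_vector_ge:
  fixes U :: "real^'m^'m" and V :: "real^'n^'n"
  assumes "orthogonal_matrix U" "orthogonal_matrix V" and "0 \<le> b"
    and "\<And>j. column j V \<bullet> v \<noteq> 0 \<Longrightarrow> idx j < CARD('m) \<and> b \<le> \<bar>s (idx j)\<bar>"
  shows "b * norm v \<le> norm ((U ** (diag_matrix s :: real^'n^'m) ** transpose V) *v v)"
proof (rule power2_le_imp_le)
  have "(\<Sum>j\<in>UNIV. b\<^sup>2 * (column j V \<bullet> v)\<^sup>2)
      \<le> (norm ((U ** (diag_matrix s :: real^'n^'m) ** transpose V) *v v))\<^sup>2"
    unfolding norm_svd_mult_vector[OF assms(1)]
  proof (rule sum_mono)
    fix j
    show "b\<^sup>2 * (column j V \<bullet> v)\<^sup>2 \<le> (if idx j < CARD('m) then (s (idx j))\<^sup>2 else 0) * (column j V \<bullet> v)\<^sup>2"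
      using assms(3) assms(4)[of j]
      by (cases "column j V \<bullet> v = 0") (auto intro!: mult_right_mono simp: abs_le_square_iff[symmetric])
  qed
  then show "(b * norm v)\<^sup>2 \<le> (norm ((U ** (diag_matrix s :: real^'n^'m) ** transpose V) *v v))\<^sup>2"
    by (simp add: sum_distrib_left[symmetric] sum_column_inner_square[OF assms(2)] power_mult_distrib)
qed simp

section \<open>Perturbation of singular values\<close>

text \<open>For orthogonal \<open>V\<close>, the span of the columns numbered by \<open>I\<close>;
  orthogonality to the remaining columns is the form that \<open>norm_svd_mult_vector_le\<close> and
  \<open>norm_svd_mult_vector_ge\<close> consume.\<close>

definition coord_space :: "real^'n^'n \<Rightarrow> nat set \<Rightarrow> (real^'n) set" where
  "coord_space V I = {v. \<forall>j. idx j \<notin> I \<longrightarrow> column j V \<bullet> v = 0}"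

lemma subspace_coord_space: "subspace (coord_space V I)"
  by (auto simp: subspace_def coord_space_def inner_right_distrib)

lemma dim_coord_space:
  assumes V: "orthogonal_matrix (V :: real^'n^'n)"
  shows "dim (coord_space V I) = card (I \<inter> {..<CARD('n)})"
proof -
  let ?S = "{x :: real^'n. \<forall>i. i \<notin> {i. idx i \<in> I} \<longrightarrow> x $ i = 0}"
  have id: "transpose V *v (V *v y) = y" "V *v (transpose V *v y) = y" for y
    using V by (simp_all add: matrix_vector_mul_assoc orthogonal_matrix_def del: transpose_matrix_vector)
  have "coord_space V I = (*v) V ` ?S"
  proof (intro equalityI subsetI)
    fix v assume "v \<in> coord_space V I"
    then have "transpose V *v v \<in> ?S"
      by (simp add: coord_space_def transpose_mult_vector_nth del: transpose_matrix_vector)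
    then show "v \<in> (*v) V ` ?S"
      by (rule image_eqI[where x = "transpose V *v v" and f = "(*v) V", OF id(2)[symmetric]])
  next
    fix v assume "v \<in> (*v) V ` ?S"
    then obtain y where "y \<in> ?S" "v = V *v y" by auto
    then show "v \<in> coord_space V I"
      by (auto simp: coord_space_def id transpose_mult_vector_nth[symmetric] simp del: transpose_matrix_vector)
  qed
  have inj: "inj_on ((*v) V) (span ?S)"
    by (rule inj_on_inverseI[where g = "(*v) (transpose V)"]) (rule id(1))
  have "dim ((*v) V ` ?S) = dim ?S"
    using inj by (rule dim_image_eq[OF matrix_vector_mul_linear])
  then show ?thesis
    using \<open>coord_space V I = (*v) V ` ?S\<close> dim_substandard_cart[where ?'a = real and d = "{i :: 'n. idx i \<in> I}"] card_idx[of I, where ?'a = 'n]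
    by (simp add: dim_vec_eq)
qed

text \<open>
  The span of the first \<open>k + 1\<close> right singular vectors of \<open>X\<close> meets the span of all but the first
  \<open>k\<close> of those of \<open>Y\<close>.
\<close>

lemma weyl_singular_value_le:
  fixes X Y :: "real^'n^'m"
  assumes X: "is_svd X U s V" and Y: "is_svd Y U' t V'" and k: "k < CARD('m)" "k < CARD('n)"
  shows "s k \<le> t k + norm (X - Y)"
proof -
  have V: "orthogonal_matrix V" "orthogonal_matrix V'" and U: "orthogonal_matrix U" "orthogonal_matrix U'"
    using X Y by (auto simp: is_svd_def)
  let ?S = "coord_space V {..k}" and ?T = "coord_space V' {k..}"
  have "{..k} \<inter> {..<CARD('n)} = {..k}" "{k..} \<inter> {..<CARD('n)} = {k..<CARD('n)}"
    using k by auto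
  then have "dim ?S + dim ?T = Suc CARD('n)"
    using k by (simp add: dim_coord_space V)
  moreover have "dim {x + y |x y. x \<in> ?S \<and> y \<in> ?T} \<le> CARD('n)"
    by (rule dim_subset_UNIV_cart)
  ultimately have "dim (?S \<inter> ?T) \<noteq> 0"
    using dim_sums_Int[OF subspace_coord_space subspace_coord_space, of V "{..k}" V' "{k..}"] by linarith
  then obtain v where v: "v \<in> ?S" "v \<in> ?T" "v \<noteq> 0"
    by (auto simp: dim_eq_0)
  have "s k * norm v \<le> norm (X *v v)"
  proof -
    have "idx j < CARD('m) \<and> s k \<le> \<bar>s (idx j)\<bar>" if "column j V \<bullet> v \<noteq> 0" for j
    proof -
      have "idx j \<le> k" using that v(1) by (auto simp: coord_space_def)
      then show ?thesis using X k by (fastforce simp: is_svd_def)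
    qed
    moreover have "0 \<le> s k" using X k by (auto simp: is_svd_def)
    ultimately show ?thesis
      using X norm_svd_mult_vector_ge[OF U(1) V(1), of "s k" v s] by (simp add: is_svd_def)
  qed
  also have "norm (X *v v) \<le> norm (Y *v v) + norm ((X - Y) *v v)"
    using norm_triangle_ineq[of "Y *v v" "(X - Y) *v v"] by (simp add: algebra_simps)
  also have "norm (Y *v v) \<le> t k * norm v"
  proof -
    have "\<bar>t (idx j)\<bar> \<le> t k" if "column j V' \<bullet> v \<noteq> 0" "idx j < CARD('m)" for j
    proof -
      have "k \<le> idx j" using that v(2) by (auto simp: coord_space_def)
      then show ?thesis using Y that idx_less[of j] by (auto simp: is_svd_def)
    qed
    moreover have "0 \<le> t k" using Y k by (auto simp: is_svd_def)
    ultimately show ?thesis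
      using Y norm_svd_mult_vector_le[OF U(2) V(2), of "t k" v t] by (simp add: is_svd_def)
  qed
  also have "norm ((X - Y) *v v) \<le> norm (X - Y) * norm v"
    by (rule norm_matrix_vector_le)
  finally have "s k * norm v \<le> (t k + norm (X - Y)) * norm v"
    by (simp add: algebra_simps)
  then show ?thesis using v(3) by simp
qed

text \<open>A positive \<open>s k\<close> would make X injective on the span of the first k + 1
  right singular vectors, forcing rank at least k + 1.\<close>

lemma svd_rank_zero:
  fixes X :: "real^'n^'m"
  assumes X: "is_svd X U s V" and k: "k < CARD('m)" "k < CARD('n)" "rank X \<le> k"
  shows "s k = 0"
proof (rule ccontr)
  assume "s k \<noteq> 0"
  have UV: "orthogonal_matrix U" "orthogonal_matrix V"
    using X by (auto simp: is_svd_def)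
  let ?S = "coord_space V {..k}"
  have pos: "0 < s k" using X k \<open>s k \<noteq> 0\<close> by (fastforce simp: is_svd_def)
  have ge: "s k * norm v \<le> norm (X *v v)" if "v \<in> ?S" for v
  proof -
    have "idx j < CARD('m) \<and> s k \<le> \<bar>s (idx j)\<bar>" if "column j V \<bullet> v \<noteq> 0" for j
    proof -
      have "idx j \<le> k" using that \<open>v \<in> ?S\<close> by (auto simp: coord_space_def)
      then show ?thesis using X k by (fastforce simp: is_svd_def)
    qed
    then show ?thesis
      using X pos norm_svd_mult_vector_ge[OF UV, of "s k" v s] by (simp add: is_svd_def)
  qed
  have "inj_on ((*v) X) ?S"
  proof (rule inj_onI)
    fix x y assume xy: "x \<in> ?S" "y \<in> ?S" "X *v x = X *v y"
    then have "x - y \<in> ?S" by (simp add: subspace_coord_space subspace_diff)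
    from ge[OF this] xy pos show "x = y" by (simp add: algebra_simps mult_le_0_iff)
  qed
  then have "dim ((*v) X ` ?S) = dim ?S"
    by (intro dim_image_eq) (simp_all add: span_eq_iff[THEN iffD2] subspace_coord_space)
  moreover have "dim ((*v) X ` ?S) \<le> rank X"
    unfolding rank_dim_range by (intro dim_subset) auto
  moreover have "{..k} \<inter> {..<CARD('n)} = {..k}" using k by auto
  ultimately show False using k by (simp add: dim_coord_space UV)
qed

text \<open>If \<open>s k\<close> vanished, so would all later singular values, and X would factor
  through a projection of rank at most k.\<close>

lemma svd_rank_pos:
  fixes X :: "real^'n^'m"
  assumes X: "is_svd X U s V" and k: "k < rank X"
  shows "0 < s k"
proof (rule ccontr)
  assume "\<not> 0 < s k"
  have UV: "orthogonal_matrix U" "orthogonal_matrix V"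
    using X by (auto simp: is_svd_def)
  have k': "k < CARD('m)" "k < CARD('n)" using k rank_bound[of X] by auto
  have zero: "s i = 0" if "k \<le> i" "i < CARD('m)" "i < CARD('n)" for i
  proof -
    have "s i \<le> s k" "0 \<le> s i" using X that by (auto simp: is_svd_def)
    then show ?thesis using \<open>\<not> 0 < s k\<close> by linarith
  qed
  have "X = U ** diag_matrix (\<lambda>i. if i \<in> {..<k} then s i else 0) ** transpose V"
    using X zero unfolding is_svd_def
    by (auto intro!: arg_cong2[of _ _ _ _ "(**)"] diag_matrix_cong)
  also have "\<dots> = X ** coord_proj V {..<k}"
    using X svd_mult_coord_proj[OF UV(2), of U s "{..<k}"] by (simp add: is_svd_def)
  finally have "rank X \<le> rank (coord_proj V {..<k})"
    by (metis rank_mul_le_right)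
  also have "\<dots> \<le> dim (coord_space V {..<k})"
    unfolding rank_dim_range
    by (intro dim_subset) (auto simp: coord_space_def column_inner_coord_proj UV)
  also have "\<dots> \<le> k"
    by (simp add: dim_coord_space UV) (metis card_lessThan card_mono finite_lessThan inf_le1)
  finally show False using k by simp
qed

section \<open>Existence of the singular value decomposition\<close>

lemma orthogonal_matrix_rowsI:
  fixes Q :: "real^'n^'n"
  assumes "\<And>i j. Q $ i \<bullet> Q $ j = (if i = j then 1 else 0)"
  shows "orthogonal_matrix Q"
  unfolding orthogonal_matrix_orthonormal_rows
  using assms by (simp add: row_def orthogonal_def norm_eq_1)

lemma inner_matrix_rows_two:
  fixes A B C :: "real^'n^'m"
  assumes "\<And>i. i \<noteq> p \<Longrightarrow> i \<noteq> q \<Longrightarrow> A $ i = C $ i" and "p \<noteq> q"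
  shows "A \<bullet> B - C \<bullet> B = (A $ p - C $ p) \<bullet> B $ p + (A $ q - C $ q) \<bullet> B $ q"
proof -
  have "(A - C) \<bullet> B = (\<Sum>i\<in>{p, q}. (A - C) $ i \<bullet> B $ i)"
    unfolding inner_vec_def[of "A - C"]
    by (rule sum.mono_neutral_right) (auto simp: assms(1))
  then show ?thesis using assms(2) by (simp add: inner_diff_left)
qed

text \<open>A rotation in the plane of p and q can raise the contribution a of these two diagonal
  entries to sqrt (a^2 + b^2), where b is the antisymmetric part. Maximality of the identity
  therefore forces b = 0.\<close>

lemma trace_maximal_symmetric:
  fixes B :: "real^'n^'n"
  assumes max: "\<And>G. orthogonal_matrix G \<Longrightarrow> G \<bullet> B \<le> mat 1 \<bullet> B"
  shows "B $ p $ q = B $ q $ p"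
proof (rule ccontr)
  assume neq: "B $ p $ q \<noteq> B $ q $ p"
  then have "p \<noteq> q" by auto
  define a b where "a = B $ p $ p + B $ q $ q" and "b = B $ q $ p - B $ p $ q"
  define R where "R = sqrt (a\<^sup>2 + b\<^sup>2)"
  have "b \<noteq> 0" using neq by (simp add: b_def)
  then have R: "0 < R" "R\<^sup>2 = a\<^sup>2 + b\<^sup>2" by (auto simp: R_def sum_power2_gt_zero_iff)
  \<comment> \<open>Cosine and sine of the angle that maximises c * a + s * b.\<close>
  define c s where "c = a / R" and "s = b / R"
  have cs: "c * c + s * s = 1"
  proof -
    have "c * c + s * s = (a\<^sup>2 + b\<^sup>2) / R\<^sup>2"
      by (simp add: c_def s_def power2_eq_square add_divide_distrib)
    also have "\<dots> = 1" using R(1) by (simp flip: R(2))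
    finally show ?thesis .
  qed
  define G :: "real^'n^'n" where "G = (\<chi> i. if i = p then c *\<^sub>R axis p 1 - s *\<^sub>R axis q 1
      else if i = q then s *\<^sub>R axis p 1 + c *\<^sub>R axis q 1 else axis i 1)"
  have G: "G $ p = c *\<^sub>R axis p 1 - s *\<^sub>R axis q 1" "G $ q = s *\<^sub>R axis p 1 + c *\<^sub>R axis q 1"
    "\<And>i. i \<noteq> p \<Longrightarrow> i \<noteq> q \<Longrightarrow> G $ i = axis i 1"
    using \<open>p \<noteq> q\<close> by (auto simp: G_def)
  have "G $ i \<bullet> G $ j = (if i = j then 1 else 0)" for i j
    using \<open>p \<noteq> q\<close> cs
    by (cases "i = p"; cases "i = q"; cases "j = p"; cases "j = q")
      (auto simp: G inner_diff_left inner_diff_right inner_add_left inner_add_right inner_axis_axis algebra_simps)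
  then have "G \<bullet> B \<le> mat 1 \<bullet> B" by (intro max orthogonal_matrix_rowsI)
  moreover have rows: "(mat 1 :: real^'n^'n) $ i = axis i 1" for i
    by (auto simp: mat_def axis_def vec_eq_iff)
  have "G \<bullet> B - mat 1 \<bullet> B = (c - 1) * a + s * b"
    using inner_matrix_rows_two[of p q G "mat 1" B] \<open>p \<noteq> q\<close>
    by (simp add: G rows a_def b_def inner_diff_left inner_add_left inner_axis' algebra_simps)
  ultimately have "c * a + s * b \<le> a" by (simp add: algebra_simps)
  moreover have "c * a + s * b = R"
    using R by (simp add: c_def s_def add_divide_distrib[symmetric] power2_eq_square field_simps)
  ultimately have "R\<^sup>2 \<le> a\<^sup>2" using R(1) by (intro power_mono) auto
  then show False using R(2) \<open>b \<noteq> 0\<close> by simp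
qed

text \<open>Reflecting coordinate p changes the trace by minus twice the diagonal entry at p, which
  must not be an increase.\<close>

lemma trace_maximal_diag_nonneg:
  fixes B :: "real^'n^'n"
  assumes max: "\<And>G. orthogonal_matrix G \<Longrightarrow> G \<bullet> B \<le> mat 1 \<bullet> B"
  shows "0 \<le> B $ p $ p"
proof -
  define G :: "real^'n^'n" where "G = (\<chi> i. if i = p then - axis p 1 else axis i 1)"
  have rows: "(mat 1 :: real^'n^'n) $ i = axis i 1" for i
    by (auto simp: mat_def axis_def vec_eq_iff)
  have "orthogonal_matrix G"
    by (rule orthogonal_matrix_rowsI) (simp add: G_def inner_axis_axis)
  then have "0 \<le> (mat 1 - G) \<bullet> B" using max by (simp add: inner_diff_left)
  also have "\<dots> = (mat 1 - G) $ p \<bullet> B $ p"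
    unfolding inner_vec_def[of "mat 1 - G"]
    by (rule sum_UNIV_single) (simp add: G_def rows)
  also have "\<dots> = 2 * B $ p $ p"
  proof -
    have "(mat 1 - G) $ p = 2 *\<^sub>R axis p 1" by (simp add: G_def rows scaleR_2)
    then show ?thesis by (simp add: inner_axis')
  qed
  finally show ?thesis by simp
qed

lemma compact_orthogonal_matrices: "compact {U :: real^'n^'n. orthogonal_matrix U}"
proof -
  have "closed {U :: real^'n^'n. transpose U ** U = mat 1}"
    by (intro closed_Collect_eq continuous_intros bounded_linear.continuous_on[OF bounded_linear_transpose]
        bounded_bilinear.continuous_on[OF bounded_bilinear_matrix_mult])
  moreover have "norm U \<le> sqrt (real CARD('n))" if "orthogonal_matrix U" for U :: "real^'n^'n"
  proof -
    have "U \<bullet> U = (mat 1 :: real^'n^'n) \<bullet> (transpose U ** U)"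
      using inner_matrix_mult_left[of U "mat 1" U] by simp
    also have "\<dots> = real CARD('n)"
      using that by (simp add: orthogonal_matrix inner_mat_1) (simp add: mat_def)
    finally show ?thesis by (simp add: norm_eq_sqrt_inner)
  qed
  ultimately show ?thesis
    by (auto simp: compact_eq_bounded_closed orthogonal_matrix intro: boundedI)
qed

lemma inner_diag_matrix:
  "(diag_matrix u :: real^'n^'m) \<bullet> diag_matrix a = (\<Sum>k<min CARD('m) CARD('n). u k * a k)"
proof -
  have inner: "(\<Sum>j\<in>(UNIV::'n set). if k = idx j then u k * a k else 0) = (if k < CARD('n) then u k * a k else 0)"
    for k
  proof (cases "k < CARD('n)")
    case True
    then obtain l :: 'n where "idx l = k" by (rule obtain_idx)
    then show ?thesis using True by (subst sum_UNIV_single[of l]) auto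
  next
    case False
    then have "k \<noteq> idx j" for j :: 'n using idx_less[of j] by auto
    then show ?thesis using False by simp
  qed
  have "(diag_matrix u :: real^'n^'m) \<bullet> diag_matrix a =
      (\<Sum>i\<in>(UNIV::'m set). \<Sum>j\<in>(UNIV::'n set). if idx i = idx j then u (idx i) * a (idx i) else 0)"
    unfolding inner_vec_def diag_matrix_def by (auto intro!: sum.cong)
  also have "\<dots> = (\<Sum>i\<in>(UNIV::'m set). if idx i < CARD('n) then u (idx i) * a (idx i) else 0)"
    by (simp add: inner)
  also have "\<dots> = (\<Sum>k<CARD('m). if k < CARD('n) then u k * a k else 0)"
    by (rule sum.reindex_bij_betw[OF bij_betw_idx])
  also have "\<dots> = (\<Sum>k<min CARD('m) CARD('n). u k * a k)"
    by (rule sum.mono_neutral_cong_right) auto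
  finally show ?thesis .
qed

lemma orthogonal_permutation_matrix:
  assumes "inj \<sigma>"
  shows "orthogonal_matrix (\<chi> i. axis (\<sigma> i) 1 :: real^'n^'n)"
  by (rule orthogonal_matrix_rowsI) (use assms in \<open>auto simp: inner_axis_axis inj_eq\<close>)

lemma permuted_matrix_nth:
  fixes D :: "real^'n^'m" and \<sigma> :: "'m \<Rightarrow> 'm" and \<tau> :: "'n \<Rightarrow> 'n"
  shows "((\<chi> i. axis (\<sigma> i) 1) ** D ** transpose (\<chi> j. axis (\<tau> j) 1)) $ i $ j = D $ \<sigma> i $ \<tau> j"
proof -
  have left: "((\<chi> i. axis (\<sigma> i) 1) ** A) $ i $ j = A $ \<sigma> i $ j" for A :: "real^'n^'m" and j
    unfolding matrix_matrix_mult_def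
    by (simp, subst sum_UNIV_single[of "\<sigma> i"]) (auto simp: axis_def)
  have right: "(A ** transpose (\<chi> j. axis (\<tau> j) 1)) $ i $ j = A $ i $ \<tau> j" for A :: "real^'n^'m" and i
    unfolding matrix_matrix_mult_def transpose_def
    by (simp, subst sum_UNIV_single[of "\<tau> j"]) (auto simp: axis_def)
  show ?thesis by (simp add: left right)
qed

text \<open>
  A maximiser \<open>(U, V)\<close> of the inner product of \<open>U D V\<^sup>T\<close> with \<open>X\<close>, where \<open>D\<close> is diagonal with
  distinct positive weights, diagonalises \<open>X\<close>: plane rotations of \<open>U\<close> and of \<open>V\<close> give two
  symmetry conditions whose combination kills the off-diagonal entries, reflections give the signs,
  and simultaneous transpositions give the order.
\<close>

theorem svd_exists:
  fixes X :: "real^'n^'m"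
  obtains U s V where "is_svd X U s V"
proof -
  \<comment> \<open>Any positive, strictly decreasing weights would serve: distinctness kills the
    off-diagonal entries, and the decrease sorts the diagonal.\<close>
  define w :: "nat \<Rightarrow> real" where "w k = inverse (real (Suc k))" for k
  have w: "0 < w k" "w k = w l \<longleftrightarrow> k = l" "k < l \<Longrightarrow> w l < w k" for k l
    by (auto simp: w_def)
  let ?D = "diag_matrix w :: real^'n^'m"
  let ?O = "{U :: real^'m^'m. orthogonal_matrix U} \<times> {V :: real^'n^'n. orthogonal_matrix V}"
  let ?f = "\<lambda>p. (fst p ** ?D ** transpose (snd p)) \<bullet> X"
  have "compact ?O" by (intro compact_Times compact_orthogonal_matrices)
  moreover have "?O \<noteq> {}"
    by (rule ex_in_conv[THEN iffD1], rule exI[of _ "(mat 1, mat 1)"]) (simp add: orthogonal_matrix_id)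
  moreover have "continuous_on ?O ?f"
    by (intro continuous_intros bounded_linear.continuous_on[OF bounded_linear_transpose]
        bounded_bilinear.continuous_on[OF bounded_bilinear_matrix_mult])
  ultimately have "\<exists>p\<in>?O. \<forall>q\<in>?O. ?f q \<le> ?f p" by (rule continuous_attains_sup)
  then obtain p where p: "p \<in> ?O" "\<forall>q\<in>?O. ?f q \<le> ?f p" by (rule bexE)
  define U V where "U = fst p" and "V = snd p"
  have U: "orthogonal_matrix U" and V: "orthogonal_matrix V"
    using p(1) by (auto simp: U_def V_def)
  define A where "A = transpose U ** X ** V"
  have move: "(U ** Z ** transpose V) \<bullet> X = Z \<bullet> A" for Z :: "real^'n^'m"
    using inner_matrix_mult_left[of U "Z ** transpose V" X]
      inner_matrix_mult_right[of Z "transpose V" "transpose U ** X"]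
    by (simp add: A_def matrix_mul_assoc)
  have max: "(G ** ?D ** transpose H) \<bullet> A \<le> ?D \<bullet> A"
    if "orthogonal_matrix G" "orthogonal_matrix H" for G H
  proof -
    have "(U ** G, V ** H) \<in> ?O" using that U V by (auto intro: orthogonal_matrix_mul)
    from bspec[OF p(2) this] have "(U ** (G ** ?D ** transpose H) ** transpose V) \<bullet> X \<le> (U ** ?D ** transpose V) \<bullet> X"
      by (simp add: matrix_transpose_mul matrix_mul_assoc U_def V_def)
    then show ?thesis unfolding move .
  qed
  \<comment> \<open>Varying only the left or only the right factor turns the functional into a
    pairing with \<open>?B\<close> or \<open>?C\<close>, so the identity is a maximiser for both and
    the trace lemmas apply.\<close>
  let ?B = "A ** transpose ?D" and ?C = "transpose A ** ?D"
  have B: "G \<bullet> ?B \<le> mat 1 \<bullet> ?B" if "orthogonal_matrix G" for G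
    using max[OF that orthogonal_matrix_id] inner_matrix_mult_right[of G ?D A]
      inner_matrix_mult_right[of "mat 1" ?D A] by simp
  have C: "H \<bullet> ?C \<le> mat 1 \<bullet> ?C" if "orthogonal_matrix H" for H
  proof -
    have "(?D ** transpose H) \<bullet> A = H \<bullet> ?C" for H
      using inner_transpose[of "?D ** transpose H" A] inner_matrix_mult_right[of H "transpose ?D" "transpose A"]
      by (simp add: matrix_transpose_mul)
    from this[of H] this[of "mat 1"] show ?thesis
      using max[OF orthogonal_matrix_id that] by simp
  qed
  have B_nth: "?B $ i $ k = A $ i $ j * w (idx k)" if "idx j = idx k" for i k j
    unfolding matrix_matrix_mult_def transpose_def
    by (simp, subst sum_UNIV_single[of j]) (auto simp: diag_matrix_def simp flip: that)
  have C_nth: "?C $ k $ j = A $ i $ k * w (idx j)" if "idx i = idx j" for i k j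
    unfolding matrix_matrix_mult_def transpose_def
    by (simp, subst sum_UNIV_single[of i]) (auto simp: diag_matrix_def simp flip: that)
  have off: "A $ i $ j = 0" if ij: "idx i \<noteq> idx j" for i j
  proof (cases "idx i < CARD('n) \<and> idx j < CARD('m)")
    case True
    then obtain i' :: 'n and j' :: 'm where i': "idx i' = idx i" and j': "idx j' = idx j"
      by (metis obtain_idx)
    have "A $ i $ j * w (idx j) = A $ j' $ i' * w (idx i)"
      using trace_maximal_symmetric[OF B, of i j'] B_nth[of j j' i] B_nth[of i' i j'] i' j' by simp
    moreover have "A $ j' $ i' * w (idx j) = A $ i $ j * w (idx i)"
      using trace_maximal_symmetric[OF C, of i' j] C_nth[of j' j i'] C_nth[of i i' j] i' j' by simp
    ultimately have "A $ i $ j * (w (idx j))\<^sup>2 = A $ i $ j * (w (idx i))\<^sup>2"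
      unfolding power2_eq_square by (metis mult.assoc mult.commute)
    moreover have "w (idx j) \<noteq> w (idx i)" using w(2) ij by metis
    then have "(w (idx j))\<^sup>2 \<noteq> (w (idx i))\<^sup>2"
      using w(1)[of "idx i"] w(1)[of "idx j"] by (simp add: power2_eq_iff_nonneg less_imp_le)
    ultimately show ?thesis by simp
  next
    case False
    \<comment> \<open>In a rectangular matrix one of the two indices may have no partner of the
      other type. The corresponding row or column of \<open>?D\<close> is then 0, and a single
      symmetry condition suffices.\<close>
    then consider "CARD('n) \<le> idx i" | "CARD('m) \<le> idx j" by linarith
    then show ?thesis
    proof cases
      case 1
      then have "idx j < CARD('m)" using idx_less[of i] idx_less[of j] by linarith
      then obtain j' :: 'm where j': "idx j' = idx j" by (rule obtain_idx)
      have "idx i \<noteq> idx k" for k :: 'n using idx_less[of k] 1 by auto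
      then have "?B $ j' $ i = 0"
        by (simp add: matrix_matrix_mult_def transpose_def diag_matrix_def)
      then show ?thesis
        using trace_maximal_symmetric[OF B, of i j'] B_nth[of j j' i] j' w(1)[of "idx j"] by simp
    next
      case 2
      then have "idx i < CARD('n)" using idx_less[of i] idx_less[of j] by linarith
      then obtain i' :: 'n where i': "idx i' = idx i" by (rule obtain_idx)
      have "idx k \<noteq> idx j" for k :: 'm using idx_less[of k] 2 by auto
      then have "?C $ i' $ j = 0"
        by (simp add: matrix_matrix_mult_def transpose_def diag_matrix_def)
      then show ?thesis
        using trace_maximal_symmetric[OF C, of i' j] C_nth[of i i' j] i' w(1)[of "idx i"] by simp
    qed
  qed
  define a where "a k = A $ inv idx k $ inv idx k" for k
  have "inj (idx :: 'm \<Rightarrow> nat)" "inj (idx :: 'n \<Rightarrow> nat)" by (auto intro: injI)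
  then have a: "a k = A $ i $ j" if "idx i = k" "idx j = k" for i j k
    using inv_f_f[OF \<open>inj (idx :: 'm \<Rightarrow> nat)\<close>, of i] inv_f_f[OF \<open>inj (idx :: 'n \<Rightarrow> nat)\<close>, of j] that
    by (simp add: a_def)
  have "A $ i $ j = diag_matrix a $ i $ j" for i j
    using off a by (simp add: diag_matrix_def)
  then have A: "A = diag_matrix a" by (simp add: vec_eq_iff)
  have nonneg: "0 \<le> a k" if k: "k < CARD('m)" "k < CARD('n)" for k
  proof -
    obtain i :: 'm and j :: 'n where ij: "idx i = k" "idx j = k" using k by (metis obtain_idx)
    then show ?thesis
      using trace_maximal_diag_nonneg[OF B, of i] B_nth[of j i i] w(1)[of k] a[OF ij]
      by (simp add: zero_le_mult_iff)
  qed
  have mono: "a l \<le> a k" if kl: "k < l" "l < min CARD('m) CARD('n)" for k l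
  proof -
    have l: "l < CARD('m)" "l < CARD('n)" and k: "k < CARD('m)" "k < CARD('n)"
      using kl by auto
    obtain ik il :: 'm and jk jl :: 'n where ij: "idx ik = k" "idx il = l" "idx jk = k" "idx jl = l"
      using obtain_idx[OF k(1)] obtain_idx[OF k(2)] obtain_idx[OF l(1)] obtain_idx[OF l(2)] by metis
    \<comment> \<open>Exchanging k and l on both sides keeps the competitor diagonal and only
      permutes its weights; optimality becomes the rearrangement inequality (w k - w l) * (a l - a
      k) <= 0.\<close>
    define sw where "sw x = (if x = k then l else if x = l then k else x)" for x
    define \<sigma> where "\<sigma> i = (if i = ik then il else if i = il then ik else i)" for i
    define \<tau> where "\<tau> j = (if j = jk then jl else if j = jl then jk else j)" for j
    have idx: "idx (\<sigma> i) = sw (idx i)" "idx (\<tau> j) = sw (idx j)" for i j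
      using ij by (auto simp: \<sigma>_def \<tau>_def sw_def simp flip: idx_eq_iff)
    have "sw x = sw y \<longleftrightarrow> x = y" for x y by (auto simp: sw_def)
    then have perm: "(\<chi> i. axis (\<sigma> i) 1) ** ?D ** transpose (\<chi> j. axis (\<tau> j) 1) = diag_matrix (\<lambda>k. w (sw k))"
      by (simp add: vec_eq_iff permuted_matrix_nth diag_matrix_def idx)
    have "inj \<sigma>" "inj \<tau>" by (auto simp: \<sigma>_def \<tau>_def inj_def)
    from max[OF this[THEN orthogonal_permutation_matrix]] perm
    have "(\<Sum>k<min CARD('m) CARD('n). w (sw k) * a k) \<le> (\<Sum>k<min CARD('m) CARD('n). w k * a k)"
      by (simp add: A inner_diag_matrix)
    then have "(\<Sum>k<min CARD('m) CARD('n). (w (sw k) - w k) * a k) \<le> 0"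
      by (simp add: sum_subtractf left_diff_distrib)
    also have "(\<Sum>k<min CARD('m) CARD('n). (w (sw k) - w k) * a k) = (\<Sum>k\<in>{k, l}. (w (sw k) - w k) * a k)"
      using kl by (intro sum.mono_neutral_right) (auto simp: sw_def)
    also have "\<dots> = (w k - w l) * (a l - a k)"
      using kl by (simp add: sw_def algebra_simps)
    finally show ?thesis using w(3)[OF kl(1)] by (simp add: mult_le_0_iff)
  qed
  have "X = (U ** transpose U) ** X ** (V ** transpose V)"
    using U V by (simp add: orthogonal_matrix_def)
  also have "\<dots> = U ** diag_matrix a ** transpose V"
    by (simp add: A[symmetric] A_def matrix_mul_assoc)
  finally have "is_svd X U a V"
    using U V nonneg mono by (auto simp: is_svd_def order.order_iff_strict)
  then show thesis by (rule that)
qed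

section \<open>Subspace angles and orthogonal projections\<close>

text \<open>The cosines are the values of a continuous function on a product of two compact unit
  spheres, so a maximum is attained. The value 1 would be equality in Cauchy-Schwarz and would give
  a common unit vector, up to sign.\<close>

lemma subspace_angle_exists:
  fixes S T :: "'a::euclidean_space set"
  assumes S: "subspace S" and T: "subspace T" and ST: "T \<inter> S = {0}"
  obtains \<theta> where "is_subspace_angle S T \<theta>" "0 < \<theta>" "\<theta> \<le> pi / 2"
proof (cases "subspace_cosines S T = {}")
  case True
  then have "is_subspace_angle S T (pi / 2)" by (simp add: is_subspace_angle_def)
  then show thesis by (rule that) auto
next
  case False
  let ?K = "(S \<inter> sphere 0 1) \<times> (T \<inter> sphere 0 1)"
  let ?f = "\<lambda>p. \<bar>fst p \<bullet> snd p\<bar>"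
  have cosines: "subspace_cosines S T = ?f ` ?K"
  proof (intro equalityI subsetI)
    fix c assume "c \<in> subspace_cosines S T"
    then obtain x y where xy: "c = \<bar>x \<bullet> y\<bar> / (norm x * norm y)" "x \<in> S" "x \<noteq> 0" "y \<in> T" "y \<noteq> 0"
      by (auto simp: subspace_cosines_def)
    then have "(x /\<^sub>R norm x, y /\<^sub>R norm y) \<in> ?K" using S T by (simp add: subspace_scale)
    moreover have "c = ?f (x /\<^sub>R norm x, y /\<^sub>R norm y)"
      by (simp add: xy(1) abs_mult divide_inverse)
    ultimately show "c \<in> ?f ` ?K" by (rule image_eqI[rotated])
  next
    fix c assume "c \<in> ?f ` ?K"
    then obtain x y where "x \<in> S" "norm x = 1" "y \<in> T" "norm y = 1" "c = \<bar>x \<bullet> y\<bar>" by auto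
    then show "c \<in> subspace_cosines S T"
      unfolding subspace_cosines_def by (intro CollectI exI[of _ x] exI[of _ y]) auto
  qed
  have "compact (subspace_cosines S T)"
    unfolding cosines
    by (intro compact_continuous_image continuous_intros compact_Times closed_Int_compact
        closed_subspace S T compact_sphere)
  then obtain c where c: "c \<in> subspace_cosines S T" "\<forall>d\<in>subspace_cosines S T. d \<le> c"
    using False compact_attains_sup by blast
  then obtain x y where xy: "x \<in> S" "norm x = 1" "y \<in> T" "norm y = 1" "c = \<bar>x \<bullet> y\<bar>"
    unfolding cosines by auto
  have "c \<noteq> 1"
  proof
    assume "c = 1"
    then have "\<bar>x \<bullet> y\<bar> = norm x * norm y" using xy by simp
    then have "x = y \<or> x = - y" using xy norm_cauchy_schwarz_abs_eq[of x y] by auto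
    then have "x \<in> T \<inter> S" using xy T by (auto dest: subspace_neg)
    then show False using ST xy(2) by auto
  qed
  moreover have "c \<le> 1" using xy Cauchy_Schwarz_ineq2[of x y] by simp
  moreover have "0 \<le> c" using xy by simp
  ultimately have "cos (arccos c) = c" "0 < arccos c" "arccos c \<le> pi / 2"
    using arccos_le_pi2[of c] arccos_lt_bounded[of c] by (auto simp: less_le arccos_eq_0_iff)
  moreover from this c False have "is_subspace_angle S T (arccos c)"
    by (simp add: is_subspace_angle_def)
  ultimately show thesis using that by blast
qed

lemma subspace_angle_bound:
  assumes "is_subspace_angle S T \<theta>" "x \<in> S" "y \<in> T"
  shows "\<bar>x \<bullet> y\<bar> \<le> cos \<theta> * (norm x * norm y)"
proof (cases "x = 0 \<or> y = 0")
  case False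
  then have "\<bar>x \<bullet> y\<bar> / (norm x * norm y) \<in> subspace_cosines S T"
    using assms by (auto simp: subspace_cosines_def)
  then have "\<bar>x \<bullet> y\<bar> / (norm x * norm y) \<le> cos \<theta>"
    using assms(1) by (auto simp: is_subspace_angle_def split: if_splits)
  then show ?thesis using False by (simp add: pos_divide_le_eq)
qed auto

section \<open>Orthogonal projection onto a subspace, and normalisation\<close>

lemma orth_proj:
  assumes "subspace M"
  shows "orth_proj M x \<in> M" and "y \<in> M \<Longrightarrow> orth_proj M x \<bullet> y = x \<bullet> y"
proof -
  obtain p z where pz: "p \<in> span M" "\<And>w. w \<in> span M \<Longrightarrow> orthogonal z w" "x = p + z"
    using orthogonal_subspace_decomp_exists[of M x] by blast
  have p: "p \<in> M \<and> (\<forall>y\<in>M. orthogonal (x - p) y)"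
    using pz assms by (simp add: span_eq_iff[THEN iffD2])
  have "q = p" if q: "q \<in> M \<and> (\<forall>y\<in>M. orthogonal (x - q) y)" for q
  proof -
    have "p - q \<in> M" using p q assms by (simp add: subspace_diff)
    then have "(x - q) \<bullet> (p - q) = 0" "(x - p) \<bullet> (p - q) = 0"
      using p q by (simp_all add: orthogonal_def)
    then have "(p - q) \<bullet> (p - q) = 0" by (simp add: inner_diff_left)
    then show ?thesis by simp
  qed
  with p have "orth_proj M x = p" unfolding orth_proj_def by (rule the_equality)
  with p show "orth_proj M x \<in> M" and "y \<in> M \<Longrightarrow> orth_proj M x \<bullet> y = x \<bullet> y"
    by (auto simp: orthogonal_def inner_diff_left)
qed

lemma orth_proj_id:
  assumes "subspace M" "x \<in> M"
  shows "orth_proj M x = x"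
proof -
  have "orth_proj M x - x \<in> M" using assms by (simp add: subspace_diff orth_proj)
  then have "(orth_proj M x - x) \<bullet> (orth_proj M x - x) = 0"
    using orth_proj(2)[OF assms(1), of "orth_proj M x - x" x] by (simp add: inner_diff_left)
  then show ?thesis by simp
qed

text \<open>If phi is the angle between x and e, the left side is the chord 2 sin (phi / 2) and the
  right side is tan phi. In the proof \<open>\<rho>\<close> is 1 / cos phi, and the squares compared
  are 2 - 2 / \<open>\<rho>\<close> and \<open>\<rho>\<close>^2 - 1.\<close>

lemma norm_normalize_diff_le:
  fixes x e :: "'a::real_inner"
  assumes e: "norm e = 1" and pos: "0 < x \<bullet> e"
  shows "norm (x /\<^sub>R norm x - e) \<le> norm (x - (x \<bullet> e) *\<^sub>R e) / (x \<bullet> e)"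
proof (rule power2_le_imp_le)
  define a \<rho> where "a = x \<bullet> e" and "\<rho> = norm x / a"
  have "a \<le> norm x" using norm_cauchy_schwarz[of x e] e by (simp add: a_def)
  have "0 < a" using pos by (simp add: a_def)
  have "1 \<le> \<rho>" using \<open>a \<le> norm x\<close> \<open>0 < a\<close> by (simp add: \<rho>_def)
  have "x \<noteq> 0" using pos by auto
  have ee: "e \<bullet> e = 1" using e by (simp add: norm_eq_1)
  have "(norm (x /\<^sub>R norm x - e))\<^sup>2 = 2 - 2 / \<rho>"
    using \<open>x \<noteq> 0\<close> \<open>0 < a\<close> ee
    by (simp add: power2_norm_eq_inner inner_diff_left inner_diff_right inner_commute[of e x] \<rho>_def
        field_simps flip: a_def) (simp add: power2_norm_eq_inner[symmetric] power2_eq_square)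
  also have "\<dots> \<le> 2 * (\<rho> - 1)"
  proof -
    have "(\<rho> - 1)\<^sup>2 \<ge> 0" by simp
    then have "2 * \<rho> - 1 \<le> \<rho> * \<rho>" by (simp add: power2_eq_square algebra_simps)
    then show ?thesis using \<open>1 \<le> \<rho>\<close> by (simp add: field_simps)
  qed
  also have "\<dots> \<le> (\<rho> + 1) * (\<rho> - 1)"
    using \<open>1 \<le> \<rho>\<close> by (intro mult_right_mono) auto
  also have "\<dots> = ((norm x)\<^sup>2 - a\<^sup>2) / a\<^sup>2"
    using \<open>0 < a\<close> by (simp add: \<rho>_def field_simps power2_eq_square)
  also have "(norm x)\<^sup>2 - a\<^sup>2 = (norm (x - a *\<^sub>R e))\<^sup>2"
    using ee
    by (simp add: power2_norm_eq_inner inner_diff_left inner_diff_right inner_commute[of e x] flip: a_def)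
      (simp add: power2_eq_square)
  finally show "(norm (x /\<^sub>R norm x - e))\<^sup>2 \<le> (norm (x - (x \<bullet> e) *\<^sub>R e) / (x \<bullet> e))\<^sup>2"
    by (simp add: power_divide a_def)
qed (use pos in simp)

text \<open>The form of \<open>H\<close> at v is the square of the norm of X v: at least a^2 on the
  range and at most b^2 on the kernel of either projection. By
  \<open>matrix_mult_eq_zero_of_projections\<close> the kernel of each is orthogonal to the range of
  the other, so the ranges coincide.\<close>

lemma spectral_projection_unique:
  fixes X :: "real^'n^'m" and Q Q' :: "real^'n^'n"
  defines "H \<equiv> transpose X ** X"
  assumes sym: "transpose Q = Q" "transpose Q' = Q'" and idem: "Q ** Q = Q" "Q' ** Q' = Q'"
    and comm: "H ** Q = Q ** H" "H ** Q' = Q' ** H"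
    and "0 \<le> b" "b < a"
    and lower: "\<And>v. Q *v v = v \<Longrightarrow> a * norm v \<le> norm (X *v v)"
      "\<And>v. Q' *v v = v \<Longrightarrow> a * norm v \<le> norm (X *v v)"
    and upper: "\<And>v. Q *v v = 0 \<Longrightarrow> norm (X *v v) \<le> b * norm v"
      "\<And>v. Q' *v v = 0 \<Longrightarrow> norm (X *v v) \<le> b * norm v"
  shows "Q = Q'"
proof -
  have H: "v \<bullet> (H *v v) = (norm (X *v v))\<^sup>2" for v
    using dot_lmul_matrix[of "X *v v" X v]
    by (simp add: H_def power2_norm_eq_inner inner_commute flip: matrix_vector_mul_assoc)
  have zero: "(mat 1 - F) ** G = 0"
    if "transpose F = F" "transpose G = G" "F ** F = F" "G ** G = G"
      "H ** F = F ** H" "H ** G = G ** H"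
      and low: "\<And>v. G *v v = v \<Longrightarrow> a * norm v \<le> norm (X *v v)"
      and up: "\<And>v. F *v v = 0 \<Longrightarrow> norm (X *v v) \<le> b * norm v" for F G
  proof (rule matrix_mult_eq_zero_of_projections[where H = H and a = "a\<^sup>2" and b = "b\<^sup>2"])
    show "b\<^sup>2 < a\<^sup>2" using \<open>0 \<le> b\<close> \<open>b < a\<close> by (intro power_strict_mono) auto
    show "v \<bullet> (H *v v) \<le> b\<^sup>2 * (v \<bullet> v)" if "(mat 1 - F) *v v = v" for v
    proof -
      have "F *v v = 0" using that by (simp add: matrix_vector_mult_diff_rdistrib)
      from power_mono[OF up[OF this], of 2] show ?thesis
        by (simp add: H power_mult_distrib power2_norm_eq_inner)
    qed
    show "a\<^sup>2 * (v \<bullet> v) \<le> v \<bullet> (H *v v)" if "G *v v = v" for v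
    proof -
      have "0 \<le> a * norm v" using \<open>0 \<le> b\<close> \<open>b < a\<close> by simp
      from power_mono[OF low[OF that] this, of 2] show ?thesis
        by (simp add: H power_mult_distrib power2_norm_eq_inner)
    qed
  qed (simp_all add: that transpose_diff matrix_mult_diff_left matrix_mult_diff_right)
  have "Q' = Q ** Q'" "Q = Q' ** Q"
    using zero[of Q Q'] zero[of Q' Q] sym idem comm lower upper
    by (simp_all add: matrix_mult_diff_left)
  then show ?thesis by (metis matrix_transpose_mul sym)
qed

section \<open>Singular value truncation\<close>

lemma norm_coord_proj_mult_le:
  assumes U: "orthogonal_matrix (U :: real^'m^'m)"
  shows "norm (coord_proj U I ** A) \<le> norm (A :: real^'n^'m)"
proof (rule power2_le_imp_le)
  have "norm (coord_proj U I *v v) \<le> norm v" for v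
    using norm_svd_mult_vector_le[OF U U, of 1 v "indicator I"] by (simp add: coord_proj_def)
  then show "(norm (coord_proj U I ** A))\<^sup>2 \<le> (norm A)\<^sup>2"
    unfolding norm_matrix_columns column_matrix_mult by (intro sum_mono power_mono) auto
qed simp

lemma norm_mult_coord_proj_le:
  assumes "orthogonal_matrix (V :: real^'n^'n)"
  shows "norm (A ** coord_proj V I) \<le> norm (A :: real^'n^'m)"
  using norm_coord_proj_mult_le[OF assms, of I "transpose A"] norm_transpose[of "A ** coord_proj V I"]
  by (simp add: matrix_transpose_mul transpose_coord_proj norm_transpose)

lemma coord_proj_atLeast:
  assumes "orthogonal_matrix (V :: real^'n^'n)"
  shows "coord_proj V {r..} = mat 1 - coord_proj V {..<r}"
  using coord_proj_compl[OF assms, of "{..<r}"] by (simp add: Compl_lessThan)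

lemma svd_coord_proj_commute:
  assumes "is_svd X U s V"
  shows "X ** coord_proj V I = coord_proj U I ** X"
  using assms svd_mult_coord_proj[of V U s I] coord_proj_mult_svd[of U I s V]
  by (simp add: is_svd_def)

text \<open>Only the right singular projection enters, so uniqueness of the truncation reduces to
  uniqueness of that projection.\<close>

lemma svd_truncations_eq:
  "svd_truncations r X = {X ** coord_proj V {..<r} |U s V. is_svd X U s V}"
proof -
  have "U ** diag_matrix (\<lambda>k. if k < r then s k else 0) ** transpose V = X ** coord_proj V {..<r}"
    if "is_svd X U s V" for U s V
    using that svd_mult_coord_proj[of V U s "{..<r}"] by (simp add: is_svd_def)
  then show ?thesis unfolding svd_truncations_def by (intro Collect_cong) metis
qed

text \<open>Invert the first r singular values and drop the rest. The bound depends only on b, so it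
  is uniform over all X whose r-th singular value stays above b; it controls both the motion of the
  singular spaces and the curvature of the set of rank r matrices.\<close>

lemma svd_pseudoinverse:
  fixes X :: "real^'n^'m"
  assumes X: "is_svd X U s V" and r: "r \<le> CARD('m)" "r \<le> CARD('n)"
    and b: "0 < b" "\<And>k. k < r \<Longrightarrow> b \<le> s k"
  obtains K where "X ** K = coord_proj U {..<r}" "K ** X = coord_proj V {..<r}"
    "norm K \<le> real CARD('m) / b"
proof
  have UV: "orthogonal_matrix U" "orthogonal_matrix V" and X': "X = U ** diag_matrix s ** transpose V"
    using X by (auto simp: is_svd_def)
  define t where "t k = (if k < r then inverse (s k) else 0)" for k
  define K :: "real^'m^'n" where "K = V ** diag_matrix t ** transpose U"
  have st: "s k * t k = indicator {..<r} k" "t k * s k = indicator {..<r} k" for k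
    using b(2)[of k] b(1) by (auto simp: t_def)
  show "X ** K = coord_proj U {..<r}"
    unfolding X' K_def svd_mult[OF UV(2), of U s t "transpose U"] coord_proj_def st
    by (intro arg_cong2[of _ _ _ _ "(**)"] refl diag_matrix_cong) (use r in \<open>auto simp: indicator_def\<close>)
  show "K ** X = coord_proj V {..<r}"
    unfolding X' K_def matrix_mul_assoc[of _ "diag_matrix s" "transpose V", symmetric] coord_proj_def
    unfolding matrix_mul_assoc[of U "diag_matrix s" "transpose V"]
      svd_mult[OF UV(1), of V t s "transpose V"] st
    by (intro arg_cong2[of _ _ _ _ "(**)"] refl diag_matrix_cong) (use r in \<open>auto simp: indicator_def\<close>)
  have "\<bar>t k\<bar> \<le> inverse b" for k
    using b(2)[of k] b(1) by (auto simp: t_def intro: le_imp_inverse_le)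
  then have "norm (K *v v) \<le> inverse b * norm v" for v
    unfolding K_def using b(1) by (intro norm_svd_mult_vector_le UV) auto
  from norm_matrix_le_of_vector[OF this] show "norm K \<le> real CARD('m) / b"
    by (simp add: divide_inverse)
qed

lemma svd_gap_lower:
  fixes X :: "real^'n^'m"
  assumes X: "is_svd X U s V" and r: "r \<le> CARD('m)"
    and b: "0 \<le> b" "\<And>k. k < r \<Longrightarrow> b \<le> s k"
    and v: "coord_proj V {..<r} *v v = v"
  shows "b * norm v \<le> norm (X *v v)"
proof -
  have UV: "orthogonal_matrix U" "orthogonal_matrix V" and X': "X = U ** diag_matrix s ** transpose V"
    using X by (auto simp: is_svd_def)
  have "idx j < r" if "column j V \<bullet> v \<noteq> 0" for j
    using that column_inner_coord_proj[OF UV(2), of j "{..<r}" v]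
    by (auto simp: v indicator_def split: if_splits)
  then have "idx j < CARD('m) \<and> b \<le> \<bar>s (idx j)\<bar>" if "column j V \<bullet> v \<noteq> 0" for j
    using that b(2)[of "idx j"] r by (meson abs_ge_self less_le_trans order_trans)
  then show ?thesis unfolding X' by (intro norm_svd_mult_vector_ge UV b)
qed

lemma svd_gap_upper:
  fixes X :: "real^'n^'m"
  assumes X: "is_svd X U s V" and b: "0 \<le> b" "\<And>k. r \<le> k \<Longrightarrow> k < CARD('m) \<Longrightarrow> k < CARD('n) \<Longrightarrow> s k \<le> b"
    and v: "coord_proj V {..<r} *v v = 0"
  shows "norm (X *v v) \<le> b * norm v"
proof -
  have UV: "orthogonal_matrix U" "orthogonal_matrix V" and X': "X = U ** diag_matrix s ** transpose V"
    using X by (auto simp: is_svd_def)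
  have "\<bar>s (idx j)\<bar> \<le> b" if "column j V \<bullet> v \<noteq> 0" "idx j < CARD('m)" for j
  proof -
    have "r \<le> idx j"
      using that column_inner_coord_proj[OF UV(2), of j "{..<r}" v] by (auto simp: v indicator_def split: if_splits)
    then show ?thesis using b(2)[of "idx j"] that(2) X idx_less[of j] by (simp add: is_svd_def)
  qed
  then show ?thesis unfolding X' by (intro norm_svd_mult_vector_le UV b)
qed

section \<open>Singular values near a matrix of rank r\<close>

lemma svd_coord_proj_rank:
  fixes X :: "real^'n^'m"
  assumes X: "is_svd X U s V"
  shows "X ** coord_proj V {rank X..} = 0"
proof -
  have "X ** coord_proj V {rank X..} = U ** diag_matrix (\<lambda>k. if k \<in> {rank X..} then s k else 0) ** transpose V"
    using X svd_mult_coord_proj[of V U s "{rank X..}"] by (simp add: is_svd_def)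
  also have "diag_matrix (\<lambda>k. if k \<in> {rank X..} then s k else 0) = (diag_matrix (\<lambda>_. 0) :: real^'n^'m)"
    using svd_rank_zero[OF X] by (intro diag_matrix_cong) auto
  also have "\<dots> = 0" by (simp add: diag_matrix_def vec_eq_iff)
  finally show ?thesis by simp
qed

lemma svd_last_le:
  fixes X :: "real^'n^'m"
  assumes "is_svd X U s V" "k < rank X"
  shows "s (rank X - 1) \<le> s k"
proof -
  have "k \<le> rank X - 1" "rank X - 1 < min CARD('m) CARD('n)"
    using rank_bound[of X] assms(2) by auto
  then show ?thesis using assms(1) unfolding is_svd_def by blast
qed

lemma svd_gram_commute:
  assumes "is_svd X U s V"
  shows "transpose X ** X ** coord_proj V I = coord_proj V I ** (transpose X ** X)"
proof -
  have "transpose X ** coord_proj U I = coord_proj V I ** transpose X"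
    using arg_cong[OF svd_coord_proj_commute[OF assms, of I], of transpose]
    by (simp add: matrix_transpose_mul transpose_coord_proj)
  then have "transpose X ** coord_proj U I ** X = coord_proj V I ** transpose X ** X"
    by simp
  then show ?thesis
    using svd_coord_proj_commute[OF assms, of I] by (metis matrix_mul_assoc)
qed

text \<open>Weyl's inequality, applied in both directions against \<open>Xs\<close>, whose r-th
  singular value is \<open>s (r - 1)\<close> (numbering starts at 0) and whose later ones vanish. A
  distance below a quarter of that value leaves a gap between a quarter and a half of it.\<close>

lemma svd_near_gap:
  fixes X Xs :: "real^'n^'m"
  assumes Xs: "is_svd Xs U s V" and X: "is_svd X U' s' V'" and r: "rank Xs = r" "1 \<le> r"
    and near: "norm (X - Xs) < s (r - 1) / 4"
  shows "k < r \<Longrightarrow> s (r - 1) / 2 \<le> s' k"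
    and "r \<le> k \<Longrightarrow> k < CARD('m) \<Longrightarrow> k < CARD('n) \<Longrightarrow> s' k \<le> norm (X - Xs)"
proof -
  have rmn: "r \<le> CARD('m)" "r \<le> CARD('n)" using rank_bound[of Xs] r by auto
  show "s (r - 1) / 2 \<le> s' k" if "k < r"
  proof -
    have "s (r - 1) \<le> s k" using svd_last_le[OF Xs] r that by simp
    moreover have "s k \<le> s' k + norm (X - Xs)"
      using weyl_singular_value_le[OF Xs X, of k] that rmn by (simp add: norm_minus_commute)
    ultimately show ?thesis using near norm_ge_zero[of "X - Xs"] by linarith
  qed
  show "s' k \<le> norm (X - Xs)" if "r \<le> k" "k < CARD('m)" "k < CARD('n)"
    using weyl_singular_value_le[OF X Xs that(2,3)] svd_rank_zero[OF Xs that(2,3)] r that by simp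
qed

section \<open>Orthogonal projection onto the tangent space of the rank r matrices\<close>

definition tangent_proj :: "nat \<Rightarrow> real^'m^'m \<Rightarrow> real^'n^'n \<Rightarrow> real^'n^'m \<Rightarrow> real^'n^'m" where
  "tangent_proj r U V Z = Z - coord_proj U {r..} ** Z ** coord_proj V {r..}"

text \<open>In the coordinates \<open>transpose U ** Z ** V\<close> the projection erases the lower
  right block, which is the normal component.\<close>

lemma tangent_proj_mem:
  fixes U :: "real^'m^'m" and V :: "real^'n^'n"
  assumes U: "orthogonal_matrix U" and V: "orthogonal_matrix V"
  shows "tangent_proj r U V Z \<in> rank_tangent r U V"
proof -
  define Z' where "Z' = transpose U ** Z ** V"
  let ?Dm = "diag_matrix (indicator {r..}) :: real^'m^'m"
  let ?Dn = "diag_matrix (indicator {r..}) :: real^'n^'n"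
  define W where "W = Z' - ?Dm ** Z' ** ?Dn"
  have "U ** Z' ** transpose V = (U ** transpose U) ** Z ** (V ** transpose V)"
    by (simp add: Z'_def matrix_mul_assoc)
  then have Z: "U ** Z' ** transpose V = Z" using U V by (simp add: orthogonal_matrix_def)
  have "U ** (?Dm ** Z' ** ?Dn) ** transpose V = coord_proj U {r..} ** Z ** coord_proj V {r..}"
    by (simp add: Z'_def coord_proj_def matrix_mul_assoc)
  then have "tangent_proj r U V Z = U ** W ** transpose V"
    by (simp add: W_def tangent_proj_def matrix_mult_diff_left matrix_mult_diff_right Z)
  moreover have "W $ i $ j = 0" if "r \<le> idx i" "r \<le> idx j" for i j
  proof -
    have left: "(?Dm ** A) $ i $ k = A $ i $ k" for A :: "real^'n^'m" and k
      unfolding matrix_matrix_mult_def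
      by (simp, subst sum_UNIV_single[of i]) (use that in \<open>auto simp: diag_matrix_def\<close>)
    have right: "(A ** ?Dn) $ k $ j = A $ k $ j" for A :: "real^'n^'m" and k
      unfolding matrix_matrix_mult_def
      by (simp, subst sum_UNIV_single[of j]) (use that in \<open>auto simp: diag_matrix_def\<close>)
    show ?thesis by (simp add: W_def left right)
  qed
  ultimately show ?thesis unfolding rank_tangent_def by blast
qed

lemma subspace_rank_tangent: "subspace (rank_tangent r U V)"
proof -
  have s: "subspace {W :: real^'n^'m. \<forall>i j. r \<le> idx i \<and> r \<le> idx j \<longrightarrow> W $ i $ j = 0}"
    by (auto simp: subspace_def)
  have l: "linear (\<lambda>W. U ** W ** transpose V)"
    by (rule linearI) (simp_all add: matrix_add_ldistrib matrix_mult_add_left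
        matrix_mult_scaleR_left matrix_mult_scaleR_right)
  have "rank_tangent r U V =
      (\<lambda>W. U ** W ** transpose V) ` {W. \<forall>i j. r \<le> idx i \<and> r \<le> idx j \<longrightarrow> W $ i $ j = 0}"
    by (auto simp: rank_tangent_def)
  then show ?thesis using linear_subspace_image[OF l s] by simp
qed

text \<open>Compression to the normal block is self-adjoint and idempotent, so tangent and normal
  parts are orthogonal.\<close>

lemma inner_tangent_proj:
  fixes U :: "real^'m^'m" and V :: "real^'n^'n"
  assumes U: "orthogonal_matrix U" and V: "orthogonal_matrix V"
  shows "tangent_proj r U V Y \<bullet> Z = tangent_proj r U V Y \<bullet> tangent_proj r U V Z"
proof -
  let ?P = "coord_proj U {r..}" and ?Q = "coord_proj V {r..}"
  have adj: "(?P ** Y ** ?Q) \<bullet> Z = Y \<bullet> (?P ** Z ** ?Q)" for Y Z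
    using inner_matrix_mult_left[of ?P "Y ** ?Q" Z] inner_matrix_mult_right[of Y ?Q "?P ** Z"]
    by (simp add: transpose_coord_proj matrix_mul_assoc)
  have "?P ** (?P ** Y ** ?Q) ** ?Q = (?P ** ?P) ** Y ** (?Q ** ?Q)"
    by (simp add: matrix_mul_assoc)
  then have idem: "?P ** (?P ** Y ** ?Q) ** ?Q = ?P ** Y ** ?Q"
    by (simp add: coord_proj_mult U V)
  have "(?P ** Y ** ?Q) \<bullet> (?P ** Z ** ?Q) = (?P ** Y ** ?Q) \<bullet> Z"
    using adj[of "?P ** Y ** ?Q" Z] by (simp add: idem)
  then show ?thesis
    by (simp add: tangent_proj_def inner_diff_left inner_diff_right adj)
qed

lemma tangent_proj_diff: "tangent_proj r U V (Y - Z) = tangent_proj r U V Y - tangent_proj r U V Z"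
  by (simp add: tangent_proj_def matrix_mult_diff_left matrix_mult_diff_right)

lemma tangent_proj_scaleR: "tangent_proj r U V (c *\<^sub>R Z) = c *\<^sub>R tangent_proj r U V Z"
  by (simp add: tangent_proj_def matrix_mult_scaleR_left matrix_mult_scaleR_right scaleR_diff_right)

text \<open>The pairing of the tangent part with \<open>Z\<close> is the square of its norm, so a
  bound on the cosine becomes a bound on the length. It is applied with c = cos theta on the tangent
  space of the sphere, and with c = 1 in general.\<close>

lemma norm_tangent_proj_le:
  fixes U :: "real^'m^'m" and V :: "real^'n^'n"
  assumes "orthogonal_matrix U" "orthogonal_matrix V" and "0 \<le> c"
    and "\<bar>tangent_proj r U V Z \<bullet> Z\<bar> \<le> c * (norm (tangent_proj r U V Z) * norm Z)"
  shows "norm (tangent_proj r U V Z) \<le> c * norm Z"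
proof (cases "tangent_proj r U V Z = 0")
  case False
  let ?t = "norm (tangent_proj r U V Z)"
  have "?t * ?t \<le> ?t * (c * norm Z)"
    using assms(4) inner_tangent_proj[OF assms(1,2), of r Z Z]
    by (simp add: dot_square_norm power2_eq_square algebra_simps)
  then show ?thesis using False by simp
qed (use assms in simp)

text \<open>
  Let \<open>Y\<close> be the truncation, \<open>D = Y - Xs\<close> and \<open>R = X - Y\<close>, so that \<open>D\<close> differs from the tangent part of
  \<open>X - Xs\<close> by the normal part of \<open>D\<close> minus the tangent part of \<open>R\<close>. Both are quadratic: the first
  because \<open>Y = Y K' Y\<close> for the pseudoinverse \<open>K'\<close>, the second because \<open>R\<close> is normal at \<open>Y\<close> and the
  projections onto the singular spaces of \<open>Y\<close> and \<open>Xs\<close> differ by \<open>O(\<parallel>D\<parallel>)\<close>.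
\<close>

lemma truncation_perturbation:
  fixes Xs :: "real^'n^'m"
  assumes Xs: "is_svd Xs U s V" and r: "rank Xs = r" "1 \<le> r"
  obtains C where "0 < C"
    "\<And>X U' s' V'. is_svd X U' s' V' \<Longrightarrow> norm (X - Xs) < s (r - 1) / 4 \<Longrightarrow>
      norm (X ** coord_proj V' {..<r} - Xs) \<le> C * norm (X - Xs) \<and>
      norm (X ** coord_proj V' {..<r} - Xs - tangent_proj r U V (X - Xs)) \<le> C * (norm (X - Xs))\<^sup>2"
proof -
  define \<sigma> where "\<sigma> = s (r - 1)"
  let ?m = "real CARD('m)" and ?n = "real CARD('n)"
  have UV: "orthogonal_matrix U" "orthogonal_matrix V" using Xs by (auto simp: is_svd_def)
  have rmn: "r \<le> CARD('m)" "r \<le> CARD('n)" using rank_bound[of Xs] r by auto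
  have "0 < \<sigma>" using svd_rank_pos[OF Xs, of "r - 1"] r by (simp add: \<sigma>_def)
  have s_ge: "\<sigma> \<le> s k" if "k < r" for k
    using svd_last_le[OF Xs] r that by (simp add: \<sigma>_def)
  obtain K where K: "Xs ** K = coord_proj U {..<r}" "K ** Xs = coord_proj V {..<r}" "norm K \<le> ?m / \<sigma>"
    using svd_pseudoinverse[OF Xs rmn \<open>0 < \<sigma>\<close> s_ge] by blast
  \<comment> \<open>\<open>C1\<close> bounds the norm of \<open>D\<close> relative to the
    perturbation; the two summands of \<open>C2\<close> come from the normal part of
    \<open>D\<close> and the tangent part of \<open>R\<close>.\<close>
  define C1 where "C1 = 1 + ?n"
  define C2 where "C2 = C1\<^sup>2 * (2 * ?m / \<sigma>) + 2 * (?m / \<sigma>) * C1 * ?n"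
  have "0 \<le> C1" "0 \<le> C2" using \<open>0 < \<sigma>\<close> by (auto simp: C1_def C2_def)
  show thesis
  proof (rule that[of "C1 + C2"])
    show "0 < C1 + C2" using \<open>0 \<le> C2\<close> by (simp add: C1_def)
    fix X :: "real^'n^'m" and U' s' V'
    assume X: "is_svd X U' s' V'" and near: "norm (X - Xs) < s (r - 1) / 4"
    define \<epsilon> where "\<epsilon> = norm (X - Xs)"
    have eps: "0 \<le> \<epsilon>" "\<epsilon> < \<sigma> / 4" using near by (auto simp: \<epsilon>_def \<sigma>_def)
    have UV': "orthogonal_matrix U'" "orthogonal_matrix V'" using X by (auto simp: is_svd_def)
    let ?P1 = "coord_proj U' {..<r}" and ?Q1 = "coord_proj V' {..<r}"
    let ?P1c = "coord_proj U' {r..}" and ?Q1c = "coord_proj V' {r..}"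
    let ?P = "coord_proj U {..<r}" and ?Q = "coord_proj V {..<r}"
    let ?Pc = "coord_proj U {r..}" and ?Qc = "coord_proj V {r..}"
    define Y where "Y = X ** ?Q1"
    define R where "R = X - Y"
    define D where "D = Y - Xs"
    have s'_le: "s' k \<le> \<epsilon>" if "r \<le> k" "k < CARD('m)" "k < CARD('n)" for k
      using svd_near_gap(2)[OF Xs X r near that] by (simp add: \<epsilon>_def)
    have s'_ge: "\<sigma> / 2 \<le> s' k" if "k < r" for k
      using svd_near_gap(1)[OF Xs X r near that] by (simp add: \<sigma>_def)
    have "0 < \<sigma> / 2" using \<open>0 < \<sigma>\<close> by simp
    obtain K' where K': "X ** K' = ?P1" "K' ** X = ?Q1" "norm K' \<le> ?m / (\<sigma> / 2)"
      using svd_pseudoinverse[OF X rmn \<open>0 < \<sigma> / 2\<close> s'_ge] by blast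
    have Y: "Y = ?P1 ** X" by (simp add: Y_def svd_coord_proj_commute[OF X])
    have R: "R = X ** ?Q1c" "R = ?P1c ** X"
      by (simp_all add: R_def coord_proj_atLeast UV' matrix_mult_diff_left matrix_mult_diff_right)
        (simp_all add: Y_def svd_coord_proj_commute[OF X])
    have Q1c: "?Q1c ** ?Q1c = ?Q1c" "?Q1 ** ?Q1c = 0" and P1c: "?P1c ** ?P1c = ?P1c" "?P1c ** ?P1 = 0"
      by (simp_all add: coord_proj_atLeast UV' matrix_mult_diff_left matrix_mult_diff_right coord_proj_mult)
    \<comment> \<open>\<open>R\<close> carries only the trailing singular values of X, all at most
      \<open>\<epsilon>\<close>.\<close>
    have "norm (R *v v) \<le> \<epsilon> * norm v" for v
    proof -
      have "?Q1 *v (?Q1c *v v) = 0" by (simp add: matrix_vector_mul_assoc Q1c)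
      from svd_gap_upper[OF X eps(1) s'_le this] have "norm (R *v v) \<le> \<epsilon> * norm (?Q1c *v v)"
        by (simp add: R(1) matrix_vector_mul_assoc)
      also have "norm (?Q1c *v v) \<le> norm v"
        using norm_svd_mult_vector_le[OF UV'(2) UV'(2), of 1 v "indicator {r..}"] by (simp add: coord_proj_def)
      finally show ?thesis using eps(1) by (simp add: mult_left_mono)
    qed
    from norm_matrix_le_of_vector[OF this] have normR: "norm R \<le> ?n * \<epsilon>" .
    have "norm D \<le> norm (X - Xs) + norm R"
      unfolding D_def R_def using norm_triangle_ineq4[of "X - Xs" "X - Y"] by simp
    with normR have normD: "norm D \<le> C1 * \<epsilon>" by (simp add: C1_def \<epsilon>_def algebra_simps)
    have PR: "norm (?P ** R) \<le> norm D * norm K * norm R"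
    proof -
      \<comment> \<open>Because \<open>Xs ** K\<close> is \<open>?P\<close> and \<open>?P1c\<close>
        annihilates Y, the misalignment of the left singular spaces is linear in \<open>D\<close>.
        As \<open>R\<close> lies in the range of \<open>?P1c\<close>, its part in the range of
        \<open>?P\<close> is a product of two small factors.\<close>
      have eq: "?P1c ** ?P = ?P1c ** ((Xs - Y) ** K)"
        by (simp add: matrix_mult_diff_right matrix_mult_diff_left Y matrix_mul_assoc P1c)
          (simp add: K(1) matrix_mul_assoc[symmetric])
      have "norm (?P1c ** ?P) \<le> norm ((Xs - Y) ** K)"
        unfolding eq by (rule norm_coord_proj_mult_le[OF UV'(1)])
      also have "\<dots> \<le> norm D * norm K"
        using norm_matrix_mult_le[of "Xs - Y" K] by (simp add: D_def norm_minus_commute)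
      also have "norm (?P1c ** ?P) = norm (?P ** ?P1c)"
        using norm_transpose[of "?P ** ?P1c"] by (simp add: matrix_transpose_mul transpose_coord_proj)
      finally have le: "norm (?P ** ?P1c) \<le> norm D * norm K" .
      have "?P ** ?P1c ** R = ?P ** (?P1c ** ?P1c) ** X"
        by (simp add: R(2) matrix_mul_assoc)
      then have "?P ** R = ?P ** ?P1c ** R"
        by (simp add: P1c(1) R(2) matrix_mul_assoc)
      then have "norm (?P ** R) \<le> norm (?P ** ?P1c) * norm R"
        using norm_matrix_mult_le[of "?P ** ?P1c" R] by simp
      also have "\<dots> \<le> norm D * norm K * norm R"
        using le by (rule mult_right_mono) simp
      finally show ?thesis .
    qed
    have RQ: "norm (R ** ?Q) \<le> norm D * norm K * norm R"
    proof -
      have eq: "?Q ** ?Q1c = (K ** (Xs - Y)) ** ?Q1c"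
        by (simp add: matrix_mult_diff_right matrix_mult_diff_left Y_def matrix_mul_assoc[symmetric] Q1c)
          (simp add: K(2) matrix_mul_assoc)
      have "norm (?Q ** ?Q1c) \<le> norm (K ** (Xs - Y))"
        unfolding eq by (rule norm_mult_coord_proj_le[OF UV'(2)])
      also have "\<dots> \<le> norm D * norm K"
        using norm_matrix_mult_le[of K "Xs - Y"] by (simp add: D_def norm_minus_commute mult.commute)
      also have "norm (?Q ** ?Q1c) = norm (?Q1c ** ?Q)"
        using norm_transpose[of "?Q ** ?Q1c"] by (simp add: matrix_transpose_mul transpose_coord_proj)
      finally have le: "norm (?Q1c ** ?Q) \<le> norm D * norm K" .
      have "R ** (?Q1c ** ?Q) = X ** (?Q1c ** ?Q1c) ** ?Q"
        by (simp add: R(1) matrix_mul_assoc)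
      then have "R ** ?Q = R ** (?Q1c ** ?Q)"
        by (simp add: Q1c(1) R(1))
      then have "norm (R ** ?Q) \<le> norm (?Q1c ** ?Q) * norm R"
        using norm_matrix_mult_le[of R "?Q1c ** ?Q"] by (simp add: mult.commute)
      also have "\<dots> \<le> norm D * norm K * norm R"
        using le by (rule mult_right_mono) simp
      finally show ?thesis .
    qed
    have "tangent_proj r U V R = ?P ** R + ?Pc ** (R ** ?Q)"
      by (simp add: tangent_proj_def coord_proj_atLeast UV matrix_mult_diff_left matrix_mult_diff_right matrix_mul_assoc)
    then have TR: "norm (tangent_proj r U V R) \<le> 2 * (norm D * norm K * norm R)"
      using norm_triangle_ineq[of "?P ** R" "?Pc ** (R ** ?Q)"] norm_coord_proj_mult_le[OF UV(1), of "{r..}" "R ** ?Q"]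
        PR RQ by simp
    have ND: "norm (?Pc ** D ** ?Qc) \<le> norm D * norm K' * norm D"
    proof -
      have "?P1 ** ?P1 = ?P1" by (simp add: coord_proj_mult UV')
      have "Y ** K' = ?P1 ** (X ** K')"
        by (simp add: Y matrix_mul_assoc)
      then have "Y ** K' = ?P1" using \<open>?P1 ** ?P1 = ?P1\<close> by (simp add: K'(1))
      then have "Y ** K' ** Y = (?P1 ** ?P1) ** X" by (simp add: Y matrix_mul_assoc)
      then have YKY: "Y ** K' ** Y = Y" using \<open>?P1 ** ?P1 = ?P1\<close> by (simp add: Y)
      have "(?Pc ** Y) ** K' ** (Y ** ?Qc) = ?Pc ** (Y ** K' ** Y) ** ?Qc"
        by (simp add: matrix_mul_assoc)
      then have "(?Pc ** Y) ** K' ** (Y ** ?Qc) = ?Pc ** Y ** ?Qc"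
        by (simp add: YKY)
      moreover have "?Pc ** Xs = 0" "Xs ** ?Qc = 0"
        using svd_coord_proj_rank[OF Xs] svd_coord_proj_commute[OF Xs, of "{r..}"] r by auto
      then have PD: "?Pc ** D = ?Pc ** Y" and DQ: "D ** ?Qc = Y ** ?Qc"
        by (simp_all add: D_def matrix_mult_diff_left matrix_mult_diff_right)
      \<comment> \<open>\<open>?Pc\<close> and \<open>?Qc\<close> annihilate \<open>Xs\<close>, so Y
        may be replaced by \<open>D\<close> in the identity Y = Y K' Y; the normal part of
        \<open>D\<close> is thereby visibly quadratic in \<open>D\<close>.\<close>
      ultimately have eq: "?Pc ** D ** ?Qc = (?Pc ** D) ** K' ** (D ** ?Qc)"
        by simp
      have "norm (?Pc ** D ** ?Qc) \<le> norm (?Pc ** D ** K') * norm (D ** ?Qc)"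
        unfolding eq by (rule norm_matrix_mult_le)
      also have "\<dots> \<le> norm (?Pc ** D) * norm K' * norm (D ** ?Qc)"
        by (intro mult_right_mono norm_matrix_mult_le) simp
      also have "\<dots> \<le> norm D * norm K' * norm D"
        by (intro mult_mono norm_coord_proj_mult_le norm_mult_coord_proj_le UV) auto
      finally show ?thesis .
    qed
    have "D - tangent_proj r U V (X - Xs) = ?Pc ** D ** ?Qc - tangent_proj r U V R"
    proof -
      have "R = (X - Xs) - D" by (simp add: D_def R_def)
      then have "tangent_proj r U V R = tangent_proj r U V (X - Xs) - tangent_proj r U V D"
        by (simp only: tangent_proj_diff)
      then show ?thesis by (simp add: tangent_proj_def[of r U V D])
    qed
    then have "norm (D - tangent_proj r U V (X - Xs)) \<le> norm D * norm K' * norm D + 2 * (norm D * norm K * norm R)"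
      using norm_triangle_ineq4[of "?Pc ** D ** ?Qc" "tangent_proj r U V R"] ND TR by simp
    also have "\<dots> \<le> (C1 * \<epsilon>) * (?m / (\<sigma> / 2)) * (C1 * \<epsilon>) + 2 * ((C1 * \<epsilon>) * (?m / \<sigma>) * (?n * \<epsilon>))"
      using normD normR K(3) K'(3) eps(1) \<open>0 < \<sigma>\<close> \<open>0 \<le> C1\<close>
      by (intro add_mono mult_mono mult_nonneg_nonneg divide_nonneg_nonneg) auto
    also have "\<dots> = C2 * \<epsilon>\<^sup>2" by (simp add: C2_def power2_eq_square field_simps)
    also have "\<dots> \<le> (C1 + C2) * \<epsilon>\<^sup>2" using \<open>0 \<le> C1\<close> by (intro mult_right_mono) auto
    finally have 2: "norm (D - tangent_proj r U V (X - Xs)) \<le> (C1 + C2) * \<epsilon>\<^sup>2" .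
    have "C1 * \<epsilon> \<le> (C1 + C2) * \<epsilon>" using \<open>0 \<le> C2\<close> eps(1) by (intro mult_right_mono) auto
    with normD 2 show "norm (X ** ?Q1 - Xs) \<le> (C1 + C2) * norm (X - Xs) \<and>
        norm (X ** ?Q1 - Xs - tangent_proj r U V (X - Xs)) \<le> (C1 + C2) * (norm (X - Xs))\<^sup>2"
      by (simp add: D_def Y_def \<epsilon>_def)
  qed
qed

section \<open>Local convergence\<close>

text \<open>\<open>Q\<close> may come from anywhere: from a second decomposition of X, to prove
  uniqueness, or from \<open>Xs\<close>, when the two tangent spaces are orthogonal.\<close>

lemma svd_truncation_projection_eq:
  fixes X :: "real^'n^'m" and Q :: "real^'n^'n"
  assumes X: "is_svd X U s V" and r: "r \<le> CARD('m)"
    and b: "0 \<le> b" "b < a"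
    and large: "\<And>k. k < r \<Longrightarrow> a \<le> s k"
    and small: "\<And>k. r \<le> k \<Longrightarrow> k < CARD('m) \<Longrightarrow> k < CARD('n) \<Longrightarrow> s k \<le> b"
    and Q: "transpose Q = Q" "Q ** Q = Q" "transpose X ** X ** Q = Q ** (transpose X ** X)"
    and lower: "\<And>v. Q *v v = v \<Longrightarrow> a * norm v \<le> norm (X *v v)"
    and upper: "\<And>v. Q *v v = 0 \<Longrightarrow> norm (X *v v) \<le> b * norm v"
  shows "coord_proj V {..<r} = Q"
proof (rule spectral_projection_unique[where X = X and a = a and b = b])
  let ?Q = "coord_proj V {..<r}"
  have V: "orthogonal_matrix V" using X by (simp add: is_svd_def)
  show "?Q ** ?Q = ?Q" by (simp add: coord_proj_mult V)
  show "transpose X ** X ** ?Q = ?Q ** (transpose X ** X)"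
    by (rule svd_gram_commute[OF X])
  show "a * norm v \<le> norm (X *v v)" if "?Q *v v = v" for v
    using svd_gap_lower[OF X r _ large that] b by simp
  show "norm (X *v v) \<le> b * norm v" if "?Q *v v = 0" for v
    using svd_gap_upper[OF X b(1) small that] by simp
  show "0 \<le> b" "b < a" by (rule b)+
qed (rule transpose_coord_proj Q lower upper | assumption)+

lemma sv_truncate_eq:
  fixes X Xs :: "real^'n^'m"
  assumes Xs: "is_svd Xs U s V" and X: "is_svd X U' s' V'" and r: "rank Xs = r" "1 \<le> r"
    and near: "norm (X - Xs) < s (r - 1) / 4"
  shows "\<exists>!Y. Y \<in> svd_truncations r X" "sv_truncate r X = X ** coord_proj V' {..<r}"
proof -
  have rm: "r \<le> CARD('m)" using rank_bound[of Xs] r by auto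
  have eps: "0 \<le> norm (X - Xs)" "norm (X - Xs) < s (r - 1) / 2"
    using near norm_ge_zero[of "X - Xs"] by linarith+
  have eq: "coord_proj V'' {..<r} = coord_proj V' {..<r}" if X2: "is_svd X U'' s'' V''" for U'' s'' V''
  proof (rule svd_truncation_projection_eq[OF X2 rm eps])
    have UV: "orthogonal_matrix V'" using X by (simp add: is_svd_def)
    let ?Q = "coord_proj V' {..<r}"
    show "?Q ** ?Q = ?Q" by (simp add: coord_proj_mult UV)
    show "transpose X ** X ** ?Q = ?Q ** (transpose X ** X)"
      by (rule svd_gram_commute[OF X])
    show "s (r - 1) / 2 * norm v \<le> norm (X *v v)" if "?Q *v v = v" for v
    proof -
      have "0 \<le> s (r - 1) / 2" using eps by linarith
      then show ?thesis by (rule svd_gap_lower[OF X rm _ svd_near_gap(1)[OF Xs X r near] that])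
    qed
    show "norm (X *v v) \<le> norm (X - Xs) * norm v" if "?Q *v v = 0" for v
      using svd_gap_upper[OF X eps(1) svd_near_gap(2)[OF Xs X r near] that] by simp
  qed (rule transpose_coord_proj svd_near_gap[OF Xs X2 r near] | assumption)+
  have "svd_truncations r X = {X ** coord_proj V' {..<r}}"
  proof (intro equalityI subsetI)
    fix Y assume "Y \<in> svd_truncations r X"
    then obtain U'' s'' V'' where "is_svd X U'' s'' V''" "Y = X ** coord_proj V'' {..<r}"
      unfolding svd_truncations_eq by auto
    then show "Y \<in> {X ** coord_proj V' {..<r}}" using eq[of U'' s'' V''] by simp
  next
    fix Y assume "Y \<in> {X ** coord_proj V' {..<r}}"
    then show "Y \<in> svd_truncations r X" unfolding svd_truncations_eq using X by blast
  qed
  then show "\<exists>!Y. Y \<in> svd_truncations r X" "sv_truncate r X = X ** coord_proj V' {..<r}"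
    unfolding sv_truncate_def by simp_all
qed

text \<open>
  On the sphere, \<open>X - Xs\<close> is tangent up to second order, so one step acts to first order by
  projecting onto the tangent space of the rank \<open>r\<close> matrices and back, which costs a factor
  \<open>cos \<theta>\<close> each. The resulting rate \<open>(cos \<theta>)\<^sup>2\<close> absorbs all second order terms into \<open>cos \<theta>\<close>,
  except when \<open>cos \<theta> = 0\<close>; in that case the tangent spaces are orthogonal and the truncation
  of \<open>X\<close> is a multiple of \<open>Xs\<close>.
\<close>

lemma new_iterate_contraction:
  fixes M :: "(real^'n^'m) set"
  assumes M: "subspace M" and r: "1 \<le> r" "rank Xs = r" and XsB: "Xs \<in> unit_sphere_in M"
    and Xs: "is_svd Xs U s V"
    and angle: "is_subspace_angle (sphere_tangent M Xs) (rank_tangent r U V) \<theta>" and "0 < \<theta>"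
  obtains \<epsilon> where "0 < \<epsilon>" "\<And>X. X \<in> unit_sphere_in M \<Longrightarrow> norm (X - Xs) < \<epsilon> \<Longrightarrow>
      new_iterate_defined M r X \<and> norm (new_iterate M r X - Xs) \<le> cos \<theta> * norm (X - Xs)"
proof -
  have UV: "orthogonal_matrix U" "orthogonal_matrix V" using Xs by (auto simp: is_svd_def)
  let ?T = "tangent_proj r U V" and ?S = "sphere_tangent M Xs"
  have XsM: "Xs \<in> M" and norm_Xs: "norm Xs = 1" and Xs1: "Xs \<bullet> Xs = 1"
    using XsB by (auto simp: unit_sphere_in_def norm_eq_1)
  define c \<sigma> where "c = cos \<theta>" and "\<sigma> = s (r - 1)"
  have "0 < \<sigma>" using svd_rank_pos[OF Xs, of "r - 1"] r by (simp add: \<sigma>_def)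
  have \<theta>: "\<theta> \<le> pi / 2" using angle by (simp add: is_subspace_angle_def)
  have "0 \<le> c" unfolding c_def using \<open>0 < \<theta>\<close> \<theta> by (intro cos_ge_zero) auto
  have "c < 1" unfolding c_def using cos_monotone_0_pi[of 0 \<theta>] \<open>0 < \<theta>\<close> \<theta> by simp
  obtain C where "0 < C" and C: "\<And>X U' s' V'. is_svd X U' s' V' \<Longrightarrow> norm (X - Xs) < s (r - 1) / 4 \<Longrightarrow>
      norm (X ** coord_proj V' {..<r} - Xs) \<le> C * norm (X - Xs) \<and>
      norm (X ** coord_proj V' {..<r} - Xs - ?T (X - Xs)) \<le> C * (norm (X - Xs))\<^sup>2"
    using truncation_perturbation[OF Xs r(2,1)] by blast
  have T_S: "norm (?T Z) \<le> c * norm Z" if "Z \<in> ?S" for Z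
    using subspace_angle_bound[OF angle that tangent_proj_mem[OF UV], of Z]
    by (intro norm_tangent_proj_le UV \<open>0 \<le> c\<close>) (simp add: c_def inner_commute mult.commute)
  have T_le: "norm (?T Z) \<le> norm Z" for Z
    using norm_tangent_proj_le[OF UV, of 1 r Z] Cauchy_Schwarz_ineq2[of "?T Z" Z] by simp
  \<comment> \<open>The radius within which the second order terms fit between c^2 and c. For c = 0
    the quotient would be 0, and the separate argument below puts no such restriction on the
    radius.\<close>
  define e0 where "e0 = (if c = 0 then 1 else (c - c\<^sup>2) / (1 + 2 * C))"
  \<comment> \<open>In order: the singular value gap, \<open>X \<bullet> Xs\<close> at least 1 / 2,
    positivity of \<open>\<alpha>\<close>, and room for the second order terms.\<close>
  define \<epsilon>0 where "\<epsilon>0 = Min {\<sigma> / 4, 1 / 2, 1 / (2 * C), e0}"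
  have "0 < e0"
  proof (cases "c = 0")
    case False
    then have "c * c < c * 1" using \<open>0 \<le> c\<close> \<open>c < 1\<close> by (intro mult_strict_left_mono) auto
    then show ?thesis using False \<open>0 < C\<close> by (simp add: e0_def power2_eq_square)
  qed (simp add: e0_def)
  show thesis
  proof (rule that[of \<epsilon>0])
    show "0 < \<epsilon>0" using \<open>0 < \<sigma>\<close> \<open>0 < C\<close> \<open>0 < e0\<close> by (simp add: \<epsilon>0_def)
    fix X assume XB: "X \<in> unit_sphere_in M" and near: "norm (X - Xs) < \<epsilon>0"
    define \<epsilon> where "\<epsilon> = norm (X - Xs)"
    have eps: "0 \<le> \<epsilon>" "\<epsilon> < \<sigma> / 4" "\<epsilon> < 1 / 2" "\<epsilon> < 1 / (2 * C)" "\<epsilon> < e0"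
      using near by (auto simp: \<epsilon>0_def \<epsilon>_def)
    have near': "norm (X - Xs) < s (r - 1) / 4" using eps by (simp add: \<epsilon>_def \<sigma>_def)
    have XM: "X \<in> M" and X1: "X \<bullet> X = 1"
      using XB by (auto simp: unit_sphere_in_def norm_eq_1)
    obtain U' s' V' where X: "is_svd X U' s' V'" by (rule svd_exists)
    define Y where "Y = X ** coord_proj V' {..<r}"
    have trunc: "\<exists>!Y. Y \<in> svd_truncations r X" "sv_truncate r X = Y"
      using sv_truncate_eq[OF Xs X r(2,1) near'] by (simp_all add: Y_def)
    have YC: "norm (Y - Xs) \<le> C * \<epsilon>" "norm (Y - Xs - ?T (X - Xs)) \<le> C * \<epsilon>\<^sup>2"
      using C[OF X near'] by (simp_all add: Y_def \<epsilon>_def)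
    define Z where "Z = orth_proj M Y"
    have ZM: "Z \<in> M" and Z_inner: "Z \<bullet> W = Y \<bullet> W" if "W \<in> M" for W
      using orth_proj[OF M] that by (auto simp: Z_def)
    define \<alpha> where "\<alpha> = Z \<bullet> Xs"
    have "\<alpha> = 1 + (Y - Xs) \<bullet> Xs" by (simp add: \<alpha>_def Z_inner XsM inner_diff_left Xs1)
    moreover have "\<bar>(Y - Xs) \<bullet> Xs\<bar> \<le> C * \<epsilon>"
      using Cauchy_Schwarz_ineq2[of "Y - Xs" Xs] YC(1) norm_Xs by simp
    ultimately have \<alpha>: "1 - C * \<epsilon> \<le> \<alpha>" by linarith
    have "C * \<epsilon> < 1 / 2" using eps(4) \<open>0 < C\<close> by (simp add: field_simps)
    then have "0 < \<alpha>" using \<alpha> by linarith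
    have "Z \<noteq> 0" using \<open>0 < \<alpha>\<close> by (auto simp: \<alpha>_def)
    then have "new_iterate_defined M r X" using trunc by (simp add: new_iterate_defined_def Z_def)
    have new: "new_iterate M r X = Z /\<^sub>R norm Z" using trunc by (simp add: new_iterate_def Z_def)
    define a E where "a = X \<bullet> Xs" and "E = X - a *\<^sub>R Xs"
    have a: "a = 1 - \<epsilon>\<^sup>2 / 2"
      using X1 Xs1 by (simp add: a_def \<epsilon>_def power2_norm_eq_inner inner_diff_left inner_diff_right inner_commute
          diff_divide_distrib)
    have ES: "E \<in> ?S"
      using M XM XsM Xs1
      by (simp add: sphere_tangent_def E_def subspace_diff subspace_scale orthogonal_def inner_diff_right
          a_def inner_commute)
    have "norm (new_iterate M r X - Xs) \<le> c * \<epsilon>"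
    proof (cases "c = 0")
      case True
      let ?P = "coord_proj U {..<r}" and ?Q = "coord_proj V {..<r}"
      have "?T E = 0" using T_S[OF ES] True by simp
      \<comment> \<open>\<open>E\<close> is purely normal, so X is the sum of
        \<open>a *\<^sub>R Xs\<close> and a matrix with orthogonal row and column spaces. The right
        singular projection of \<open>Xs\<close> is then also that of X, and it cuts off
        \<open>E\<close>.\<close>
      then have EN: "E = coord_proj U {r..} ** E ** coord_proj V {r..}" by (simp add: tangent_proj_def)
      have "?P ** coord_proj U {r..} = 0" "coord_proj V {r..} ** ?Q = 0"
        by (simp_all add: coord_proj_atLeast UV matrix_mult_diff_left matrix_mult_diff_right coord_proj_mult)
      then have PE: "?P ** E = 0" and EQ: "E ** ?Q = 0"
        by (subst EN, simp add: matrix_mul_assoc, subst EN, simp flip: matrix_mul_assoc)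
      have PXs: "?P ** Xs = Xs" and XsQ: "Xs ** ?Q = Xs"
        using svd_coord_proj_rank[OF Xs] svd_coord_proj_commute[OF Xs, of "{..<r}"] r
        by (simp_all add: coord_proj_atLeast UV matrix_mult_diff_right)
      have Xeq: "X = a *\<^sub>R Xs + E" by (simp add: E_def)
      have XQ: "X ** ?Q = a *\<^sub>R Xs"
        by (simp add: Xeq matrix_mult_add_left matrix_mult_scaleR_left EQ XsQ)
      have "transpose E ** Xs = transpose (?P ** E) ** Xs"
        by (simp add: matrix_transpose_mul transpose_coord_proj PXs flip: matrix_mul_assoc)
      then have EXs: "transpose E ** Xs = 0" by (simp add: PE transpose_zero)
      have "1 / 2 \<le> a"
        using eps(1,3) power_mono[of \<epsilon> "1/2" 2] by (simp add: a power2_eq_square)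
      have "coord_proj V' {..<r} = ?Q"
      proof (rule svd_truncation_projection_eq[OF X])
        show rm: "r \<le> CARD('m)" using rank_bound[of Xs] r by auto
        show "0 \<le> \<epsilon>" "\<epsilon> < \<sigma> / 2" using eps by auto
        show "\<sigma> / 2 \<le> s' k" if "k < r" for k
          using svd_near_gap(1)[OF Xs X r(2,1) near' that] by (simp add: \<sigma>_def)
        show "s' k \<le> \<epsilon>" if "r \<le> k" "k < CARD('m)" "k < CARD('n)" for k
          using svd_near_gap(2)[OF Xs X r(2,1) near' that] by (simp add: \<epsilon>_def)
        show "transpose ?Q = ?Q" "?Q ** ?Q = ?Q" by (simp_all add: transpose_coord_proj coord_proj_mult UV)
        have gram: "transpose X ** X ** ?Q = a\<^sup>2 *\<^sub>R (transpose Xs ** Xs)"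
        proof -
          have "transpose X = a *\<^sub>R transpose Xs + transpose E"
            by (subst Xeq) (simp add: transpose_add transpose_scalar)
          moreover have "transpose X ** X ** ?Q = transpose X ** (a *\<^sub>R Xs)"
            by (simp add: XQ flip: matrix_mul_assoc)
          ultimately show ?thesis
            by (simp add: matrix_mult_add_left matrix_mult_scaleR_left matrix_mult_scaleR_right EXs
                power2_eq_square)
        qed
        have "?Q ** (transpose X ** X) = transpose (transpose X ** X ** ?Q)"
          by (simp add: matrix_transpose_mul transpose_coord_proj)
        then show "transpose X ** X ** ?Q = ?Q ** (transpose X ** X)"
          unfolding gram by (simp add: transpose_scalar matrix_transpose_mul)
        show "\<sigma> / 2 * norm v \<le> norm (X *v v)" if v: "?Q *v v = v" for v
        proof -
          have "\<sigma> * norm v \<le> norm (Xs *v v)"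
            using svd_gap_lower[OF Xs rm less_imp_le[OF \<open>0 < \<sigma>\<close>] _ v] svd_last_le[OF Xs] r
            by (simp add: \<sigma>_def)
          moreover have "X *v v = a *\<^sub>R (Xs *v v)"
            by (metis XQ v matrix_vector_mul_assoc scaleR_matrix_vector_assoc)
          then have "norm (X *v v) = a * norm (Xs *v v)" using \<open>1 / 2 \<le> a\<close> by simp
          moreover have "1 / 2 * norm (Xs *v v) \<le> a * norm (Xs *v v)"
            using \<open>1 / 2 \<le> a\<close> by (rule mult_right_mono) simp
          ultimately show ?thesis by simp
        qed
        show "norm (X *v v) \<le> \<epsilon> * norm v" if v: "?Q *v v = 0" for v
        proof -
          have "Xs *v v = 0" by (metis XsQ v matrix_vector_mul_assoc matrix_vector_mult_0_right)
          then show ?thesis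
            using norm_matrix_vector_le[of "X - Xs" v] by (simp add: \<epsilon>_def matrix_vector_mult_diff_rdistrib)
        qed
      qed
      then have "Z = a *\<^sub>R Xs" using M XsM by (simp add: Z_def Y_def XQ orth_proj_id subspace_scale)
      then have "new_iterate M r X = Xs" using \<open>1 / 2 \<le> a\<close> by (simp add: new norm_Xs)
      then show ?thesis using True by simp
    next
      case False
      then have "0 < c" using \<open>0 \<le> c\<close> by simp
      \<comment> \<open>The component of Z orthogonal to \<open>Xs\<close>; by
        \<open>norm_normalize_diff_le\<close> the new error is at most its norm divided by
        \<open>\<alpha>\<close>.\<close>
      define W where "W = Z - \<alpha> *\<^sub>R Xs"
      have WM: "W \<in> M" using M ZM[OF XsM] XsM by (simp add: W_def subspace_diff subspace_scale)
      have XsW: "Xs \<bullet> W = 0" by (simp add: W_def \<alpha>_def inner_diff_right Xs1 inner_commute)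
      then have WS: "W \<in> ?S" using WM by (simp add: sphere_tangent_def orthogonal_def)
      have "norm E \<le> \<epsilon>"
      proof (rule power2_le_imp_le)
        have "(norm E)\<^sup>2 = 1 - a\<^sup>2"
          unfolding power2_norm_eq_inner using X1 Xs1
          by (simp add: E_def inner_diff_left inner_diff_right inner_commute a_def power2_eq_square)
        also have "\<dots> \<le> \<epsilon>\<^sup>2"
          using eps(1) by (simp add: a power2_eq_square algebra_simps)
        finally show "(norm E)\<^sup>2 \<le> \<epsilon>\<^sup>2" .
      qed (rule eps)
      have "X - Xs = E - (\<epsilon>\<^sup>2 / 2) *\<^sub>R Xs" by (simp add: E_def a algebra_simps)
      then have "?T (X - Xs) = ?T E - (\<epsilon>\<^sup>2 / 2) *\<^sub>R ?T Xs"
        by (simp only: tangent_proj_diff tangent_proj_scaleR)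
      then have "norm (?T (X - Xs)) \<le> norm (?T E) + \<epsilon>\<^sup>2 / 2 * norm (?T Xs)"
        using norm_triangle_ineq4[of "?T E" "(\<epsilon>\<^sup>2 / 2) *\<^sub>R ?T Xs"] by simp
      also have "\<dots> \<le> c * \<epsilon> + \<epsilon>\<^sup>2 / 2 * 1"
      proof (intro add_mono mult_left_mono)
        show "norm (?T E) \<le> c * \<epsilon>"
          using T_S[OF ES] mult_left_mono[OF \<open>norm E \<le> \<epsilon>\<close> \<open>0 \<le> c\<close>] by linarith
        show "norm (?T Xs) \<le> 1" using T_le[of Xs] norm_Xs by simp
      qed simp
      finally have TE: "norm (?T (X - Xs)) \<le> c * \<epsilon> + \<epsilon>\<^sup>2 / 2" by simp
      \<comment> \<open>Since \<open>W\<close> lies in \<open>M\<close>, Z may be replaced by Y.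
        Pairing the tangent part of X - Xs with \<open>W\<close> sees only \<open>?T W\<close>,
        which supplies the second factor c.\<close>
      have "norm W * norm W = W \<bullet> W" by (simp add: norm_eq_sqrt_inner)
      also have "\<dots> = Z \<bullet> W - \<alpha> * (Xs \<bullet> W)" by (simp add: W_def inner_diff_left)
      also have "\<dots> = (Y - Xs) \<bullet> W" using XsW Z_inner[OF WM] by (simp add: inner_diff_left)
      also have "\<dots> = (Y - Xs - ?T (X - Xs)) \<bullet> W + ?T (X - Xs) \<bullet> ?T W"
        using inner_tangent_proj[OF UV, of r "X - Xs" W] by (simp add: inner_diff_left)
      also have "\<dots> \<le> (C * \<epsilon>\<^sup>2) * norm W + (c * \<epsilon> + \<epsilon>\<^sup>2 / 2) * (c * norm W)"
      proof (intro add_mono order_trans[OF norm_cauchy_schwarz])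
        show "norm (Y - Xs - ?T (X - Xs)) * norm W \<le> C * \<epsilon>\<^sup>2 * norm W"
          using YC(2) by (rule mult_right_mono) simp
        show "norm (?T (X - Xs)) * norm (?T W) \<le> (c * \<epsilon> + \<epsilon>\<^sup>2 / 2) * (c * norm W)"
          using TE T_S[OF WS] eps(1) \<open>0 \<le> c\<close> by (intro mult_mono) auto
      qed
      also have "\<dots> = (c\<^sup>2 * \<epsilon> + (c / 2 + C) * \<epsilon>\<^sup>2) * norm W"
        by (simp add: power2_eq_square algebra_simps)
      finally have normW: "norm W \<le> c\<^sup>2 * \<epsilon> + (c / 2 + C) * \<epsilon>\<^sup>2"
        using \<open>0 < C\<close> \<open>0 < c\<close> eps(1) by (cases "norm W = 0") auto
      have "\<epsilon> * (1 + 2 * C) \<le> c - c\<^sup>2"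
        using eps(5) False \<open>0 < C\<close> by (simp add: e0_def pos_less_divide_eq)
      moreover have "(c / 2 + C + c * C) * \<epsilon> \<le> (1 + 2 * C) * \<epsilon>"
      proof (rule mult_right_mono)
        have "c * C \<le> 1 * C" using \<open>c < 1\<close> \<open>0 < C\<close> by (intro mult_right_mono) auto
        then show "c / 2 + C + c * C \<le> 1 + 2 * C" using \<open>c < 1\<close> by simp
      qed (rule eps)
      \<comment> \<open>The factor 1 - C * \<open>\<epsilon>\<close> is kept on the right to pay for
        the later division by \<open>\<alpha>\<close>, which is at least that large.\<close>
      ultimately have "c\<^sup>2 + (c / 2 + C) * \<epsilon> \<le> c * (1 - C * \<epsilon>)"
        by (simp add: algebra_simps)
      from mult_left_mono[OF this eps(1)]
      have "norm W \<le> c * \<epsilon> * (1 - C * \<epsilon>)"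
        using normW by (simp add: power2_eq_square algebra_simps)
      also have "\<dots> \<le> c * \<epsilon> * \<alpha>"
        using \<alpha> \<open>0 \<le> c\<close> eps(1) by (intro mult_left_mono) auto
      finally have "norm W / \<alpha> \<le> c * \<epsilon>" using \<open>0 < \<alpha>\<close> by (simp add: pos_divide_le_eq)
      moreover have "norm (Z /\<^sub>R norm Z - Xs) \<le> norm W / \<alpha>"
        using norm_normalize_diff_le[OF norm_Xs, of Z] \<open>0 < \<alpha>\<close> by (simp add: \<alpha>_def W_def)
      ultimately show ?thesis by (simp add: new)
    qed
    with \<open>new_iterate_defined M r X\<close>
    show "new_iterate_defined M r X \<and> norm (new_iterate M r X - Xs) \<le> cos \<theta> * norm (X - Xs)"
      by (simp add: c_def \<epsilon>_def)
  qed
qed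

lemma new_iterate_mem:
  assumes "subspace M" "new_iterate_defined M r X"
  shows "new_iterate M r X \<in> unit_sphere_in M"
  using assms by (simp add: new_iterate_defined_def new_iterate_def unit_sphere_in_def orth_proj subspace_scale)

theorem theorem4:
  fixes M :: "(real^'n^'m) set" and r :: nat and Xs :: "real^'n^'m"
    and U :: "real^'m^'m" and s :: "nat \<Rightarrow> real" and V :: "real^'n^'n"
  assumes "subspace M"
    and "1 \<le> r"
    and "Xs \<in> unit_sphere_in M"
    and "rank Xs = r"
    and "is_svd Xs U s V"
    and "rank_tangent r U V \<inter> sphere_tangent M Xs = {0}"
  shows "\<exists>\<theta>. is_subspace_angle (sphere_tangent M Xs) (rank_tangent r U V) \<theta> \<and>
      0 < \<theta> \<and> \<theta> \<le> pi/2 \<and>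
      (\<exists>g \<in> O[at Xs within unit_sphere_in M](\<lambda>X. (norm (X - Xs))\<^sup>2). \<exists>\<epsilon>>0.
        \<forall>X \<in> unit_sphere_in M. norm (X - Xs) < \<epsilon> \<longrightarrow>
          new_iterate_defined M r X \<and>
          (X \<noteq> Xs \<longrightarrow> norm (new_iterate M r X - Xs) / norm (X - Xs) \<le> cos \<theta> + g X)) \<and>
      (\<exists>\<delta>>0. \<forall>X0 \<in> unit_sphere_in M. norm (X0 - Xs) < \<delta> \<longrightarrow>
        (\<forall>k. new_iterate_defined M r ((new_iterate M r ^^ k) X0)) \<and>
        (\<lambda>k. (new_iterate M r ^^ k) X0) \<longlonglongrightarrow> Xs \<and>
        linear_rate (\<lambda>k. (new_iterate M r ^^ k) X0) Xs)"
proof -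
  let ?B = "unit_sphere_in M" and ?F = "new_iterate M r"
  have "subspace (sphere_tangent M Xs)"
    using assms(1) by (auto simp: subspace_def sphere_tangent_def orthogonal_def inner_add_right)
  then obtain \<theta> where angle: "is_subspace_angle (sphere_tangent M Xs) (rank_tangent r U V) \<theta>"
    and \<theta>: "0 < \<theta>" "\<theta> \<le> pi / 2"
    using subspace_angle_exists[OF _ subspace_rank_tangent assms(6)] by blast
  obtain \<epsilon> where "0 < \<epsilon>" and step: "\<And>X. X \<in> ?B \<Longrightarrow> norm (X - Xs) < \<epsilon> \<Longrightarrow>
      new_iterate_defined M r X \<and> norm (?F X - Xs) \<le> cos \<theta> * norm (X - Xs)"
    using new_iterate_contraction[OF assms(1,2,4,3,5) angle \<theta>(1)] by blast
  have c: "0 \<le> cos \<theta>" "cos \<theta> < 1"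
    using \<theta> cos_monotone_0_pi[of 0 \<theta>] by (auto intro: cos_ge_zero)
  have ratio: "norm (?F X - Xs) / norm (X - Xs) \<le> cos \<theta>" if "X \<in> ?B" "norm (X - Xs) < \<epsilon>" "X \<noteq> Xs" for X
    using step[OF that(1,2)] that(3) by (simp add: pos_divide_le_eq)
  have iterates: "(\<forall>k. new_iterate_defined M r ((?F ^^ k) X0)) \<and> (\<lambda>k. (?F ^^ k) X0) \<longlonglongrightarrow> Xs \<and>
      linear_rate (\<lambda>k. (?F ^^ k) X0) Xs" if X0: "X0 \<in> ?B" "norm (X0 - Xs) < \<epsilon>" for X0
  proof -
    \<comment> \<open>Staying in the ball is part of the induction, since the contraction is
      available only there.\<close>
    have inv: "(?F ^^ k) X0 \<in> ?B \<and> norm ((?F ^^ k) X0 - Xs) \<le> cos \<theta> ^ k * norm (X0 - Xs) \<and>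
        norm ((?F ^^ k) X0 - Xs) < \<epsilon>" for k
    proof (induction k)
      case (Suc k)
      let ?X = "(?F ^^ k) X0"
      have X: "?X \<in> ?B" "norm (?X - Xs) < \<epsilon>" using Suc by auto
      have "norm (?F ?X - Xs) \<le> cos \<theta> * norm (?X - Xs)" using step[OF X] by simp
      moreover have "cos \<theta> * norm (?X - Xs) \<le> 1 * norm (?X - Xs)"
        using c by (intro mult_right_mono) auto
      moreover have "cos \<theta> * norm (?X - Xs) \<le> cos \<theta> * (cos \<theta> ^ k * norm (X0 - Xs))"
        using Suc c by (intro mult_left_mono) auto
      ultimately show ?case
        using X new_iterate_mem[OF assms(1)] step[OF X] by (simp add: mult.assoc)
    qed (use X0 in simp)
    have "(\<lambda>k. cos \<theta> ^ k * norm (X0 - Xs)) \<longlonglongrightarrow> 0 * norm (X0 - Xs)"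
      using c by (intro tendsto_mult_right LIMSEQ_power_zero) auto
    then have "(\<lambda>k. cos \<theta> ^ k * norm (X0 - Xs)) \<longlonglongrightarrow> 0" by simp
    then have "(\<lambda>k. (?F ^^ k) X0 - Xs) \<longlonglongrightarrow> 0"
      by (rule Lim_null_comparison[rotated]) (use inv in auto)
    then have "(\<lambda>k. (?F ^^ k) X0) \<longlonglongrightarrow> Xs" by (simp add: LIM_zero_iff)
    moreover have "linear_rate (\<lambda>k. (?F ^^ k) X0) Xs"
      unfolding linear_rate_def using c step inv by (intro exI[of _ "cos \<theta>"]) simp
    moreover have "new_iterate_defined M r ((?F ^^ k) X0)" for k using step inv by simp
    ultimately show ?thesis by simp
  qed
  have "\<exists>g \<in> O[at Xs within ?B](\<lambda>X. (norm (X - Xs))\<^sup>2). \<exists>\<epsilon>>0.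
      \<forall>X \<in> ?B. norm (X - Xs) < \<epsilon> \<longrightarrow> new_iterate_defined M r X \<and>
        (X \<noteq> Xs \<longrightarrow> norm (?F X - Xs) / norm (X - Xs) \<le> cos \<theta> + g X)"
  \<comment> \<open>The contraction already holds with factor cos theta, so the zero function serves
    as the error term.\<close>
  proof (rule bexI[of _ "\<lambda>_. 0"], rule exI[of _ \<epsilon>], intro conjI ballI impI)
    fix X assume X: "X \<in> ?B" "norm (X - Xs) < \<epsilon>"
    show "new_iterate_defined M r X" using step[OF X] by simp
    show "norm (?F X - Xs) / norm (X - Xs) \<le> cos \<theta> + 0" if "X \<noteq> Xs"
      using ratio[OF X that] by simp
  qed (simp_all add: \<open>0 < \<epsilon>\<close>)
  moreover have "\<exists>\<delta>>0. \<forall>X0 \<in> ?B. norm (X0 - Xs) < \<delta> \<longrightarrow>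
      (\<forall>k. new_iterate_defined M r ((?F ^^ k) X0)) \<and> (\<lambda>k. (?F ^^ k) X0) \<longlonglongrightarrow> Xs \<and>
      linear_rate (\<lambda>k. (?F ^^ k) X0) Xs"
    by (rule exI[of _ \<epsilon>], intro conjI[OF \<open>0 < \<epsilon>\<close>] ballI impI) (rule iterates)
  ultimately show ?thesis
    using angle \<theta> by (intro exI[of _ \<theta>]) simp
qed

end
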